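(* Let $N\ge 2$ be an integer and let $f:[0,+\infty)\to\mathbb{R}$ be locally Lipschitz-continuous, with $f\ge 0$ on $[0,+\infty)$ and, writing $E=\{z\in[0,+\infty): f(z)=0\}$, $$\liminf_{s\to z^+}\frac{f(s)}{s-z}>0\quad\text{for all }z\in E.$$ Let $\Omega'=(0,+\infty)\times\mathbb{R}^{N-1}$, let $u_0:\mathbb{R}^{N-1}\to[0,+\infty)$ be any continuous and bounded function with $u_0\not\equiv 0$ in $\mathbb{R}^{N-1}$, and let $u$ be any nonnegative and bounded solution of $$\begin{cases}\Delta u+f(u)=0 & \text{in }\Omega',\\ u(0,x_2,\ldots,x_N)=u_0(x_2,\ldots,x_N) & \text{for all }(x_2,\ldots,x_N)\in\mathbb{R}^{N-1}.\end{cases}$$ Then there exists $z\in E\setminus\{0\}$ such that $$u(x_1+h,x_2,\ldots,x_N)\to z\quad\text{as }h\to+\infty\text{ in }C^{2,\beta}_b\big([A,+\infty)\times\mathbb{R}^{N-1}\big)$$ for all $A\in\mathbb{R}$ and $\beta\in[0,1)$.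
   Context: A bounded solution $u$ is understood to be bounded, of class $C^2(\Omega')$ and continuous on $\overline{\Omega'}$. For a closed set $F\subset\mathbb{R}^N$ and $\beta\in[0,1)$, $C^{2,\beta}_b(F)$ is the space of functions $w:F\to\mathbb{R}$ with $\|w\|_{C^{2,\beta}_b(F)}=\sup_{x\in F}\|w\|_{C^{2,\beta}(\overline{B(x,1)}\cap F)}<\infty$, where $B(x,1)$ is the open Euclidean ball of radius $1$ centered at $x$. The convergence as $h\to+\infty$ is considered for $h$ large enough (e.g. $h>-A$) so that the translated function is defined on the given set. *)

theory Defs
  imports "HOL-Analysis.Analysis"
begin

definition has_partial :: "'a::euclidean_space \<Rightarrow> ('a \<Rightarrow> real) \<Rightarrow> 'a \<Rightarrow> bool" where
  "has_partial b w x \<longleftrightarrow> (\<lambda>t::real. w (x + t *\<^sub>R b)) differentiable at 0"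

definition partial :: "'a::euclidean_space \<Rightarrow> ('a \<Rightarrow> real) \<Rightarrow> 'a \<Rightarrow> real" where
  "partial b w x = deriv (\<lambda>t::real. w (x + t *\<^sub>R b)) 0"

definition laplacian :: "('a::euclidean_space \<Rightarrow> real) \<Rightarrow> 'a \<Rightarrow> real" where
  "laplacian w x = (\<Sum>b\<in>Basis. partial b (partial b w) x)"

text \<open>Class \<open>C\<^sup>2\<close>, meaningful for open sets.\<close>

definition C2_on :: "'a::euclidean_space set \<Rightarrow> ('a \<Rightarrow> real) \<Rightarrow> bool" where
  "C2_on S w \<longleftrightarrow> continuous_on S w \<and>
    (\<forall>b\<in>Basis. (\<forall>x\<in>S. has_partial b w x) \<and> continuous_on S (partial b w) \<and>
      (\<forall>c\<in>Basis. (\<forall>x\<in>S. has_partial c (partial b w) x) \<and>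
        continuous_on S (partial c (partial b w))))"

definition bounded_solution ::
    "'a::euclidean_space set \<Rightarrow> (real \<Rightarrow> real) \<Rightarrow> ('a \<Rightarrow> real) \<Rightarrow> bool" where
  "bounded_solution \<Omega> f u \<longleftrightarrow> bounded (u ` closure \<Omega>) \<and> C2_on \<Omega> u \<and>
    continuous_on (closure \<Omega>) u \<and> (\<forall>x\<in>\<Omega>. laplacian u x + f (u x) = 0)"

text \<open>The domain of the nonlinearity is \<open>[0,\<infinity>)\<close>; its values at negative arguments are junk.\<close>

definition zeros :: "(real \<Rightarrow> real) \<Rightarrow> real set" where
  "zeros f = {z \<in> {0..}. f z = 0}"

text \<open>
  As usual, a function is of class \<open>C\<^sup>2\<close> on a closed set \<open>K\<close> if it is continuous on \<open>K\<close>, of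
  class \<open>C\<^sup>2\<close> in the interior, and its partial derivatives of order at most 2 extend continuously
  to \<open>K\<close>.  This is intended for \<open>K\<close> equal to the closure of its interior, which holds for the
  sets \<open>cball x 1 \<inter> F\<close> below when \<open>F\<close> is a closed half-space and \<open>x \<in> F\<close>.
\<close>

definition C2_closed :: "'a::euclidean_space set \<Rightarrow> ('a \<Rightarrow> real) \<Rightarrow> bool" where
  "C2_closed K w \<longleftrightarrow> continuous_on K w \<and> C2_on (interior K) w \<and>
    (\<forall>b\<in>Basis. (\<exists>g. continuous_on K g \<and> (\<forall>x\<in>interior K. g x = partial b w x)) \<and>
      (\<forall>c\<in>Basis. \<exists>g. continuous_on K g \<and> (\<forall>x\<in>interior K. g x = partial c (partial b w) x)))"

definition sup_norm :: "'a set \<Rightarrow> ('a \<Rightarrow> real) \<Rightarrow> ennreal" where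
  "sup_norm S g = (SUP x\<in>S. ennreal \<bar>g x\<bar>)"

text \<open>For \<open>\<beta> = 0\<close> this is the oscillation, at most twice the sup norm, so that the norm of
  \<open>C\<^sup>2\<^sup>,\<^sup>0\<close> below is equivalent to the usual one of \<open>C\<^sup>2\<close>.\<close>

definition holder_seminorm :: "real \<Rightarrow> 'a::metric_space set \<Rightarrow> ('a \<Rightarrow> real) \<Rightarrow> ennreal" where
  "holder_seminorm \<beta> S g =
    (SUP x\<in>S. SUP y\<in>S - {x}. ennreal (\<bar>g x - g y\<bar> / dist x y powr \<beta>))"

text \<open>Suprema of derivatives over \<open>interior K\<close> agree with those of their continuous extensions
  over \<open>K\<close>.  The norm is infinite exactly for the functions that are not of class
  \<open>C\<^sup>2\<^sup>,\<^sup>\<beta>\<close> on \<open>K\<close> (with \<open>K\<close> compact).\<close>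

definition C2_holder_norm :: "real \<Rightarrow> 'a::euclidean_space set \<Rightarrow> ('a \<Rightarrow> real) \<Rightarrow> ennreal" where
  "C2_holder_norm \<beta> K w =
    (if C2_closed K w then
       sup_norm K w
       + (\<Sum>b\<in>Basis. sup_norm (interior K) (partial b w))
       + (\<Sum>b\<in>Basis. \<Sum>c\<in>Basis. sup_norm (interior K) (partial c (partial b w)))
       + (\<Sum>b\<in>Basis. \<Sum>c\<in>Basis. holder_seminorm \<beta> (interior K) (partial c (partial b w)))
     else \<infinity>)"

definition C2b_norm :: "real \<Rightarrow> 'a::euclidean_space set \<Rightarrow> ('a \<Rightarrow> real) \<Rightarrow> ennreal" where
  "C2b_norm \<beta> F w = (SUP x\<in>F. C2_holder_norm \<beta> (cball x 1 \<inter> F) w)"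

definition C2b_space :: "real \<Rightarrow> 'a::euclidean_space set \<Rightarrow> ('a \<Rightarrow> real) set" where
  "C2b_space \<beta> F = {w. C2b_norm \<beta> F w < \<infinity>}"

definition tendsto_C2b ::
    "real \<Rightarrow> 'a::euclidean_space set \<Rightarrow> ('i \<Rightarrow> 'a \<Rightarrow> real) \<Rightarrow> ('a \<Rightarrow> real) \<Rightarrow> 'i filter \<Rightarrow> bool" where
  "tendsto_C2b \<beta> F W w G \<longleftrightarrow> w \<in> C2b_space \<beta> F \<and> (\<forall>\<^sub>F h in G. W h \<in> C2b_space \<beta> F) \<and>
    ((\<lambda>h. C2b_norm \<beta> F (\<lambda>x. W h x - w x)) \<longlongrightarrow> 0) G"

text \<open>
  \<open>\<real>\<^sup>N\<close> is represented by \<open>real \<times> real ^ 'm\<close> with \<open>N = CARD('m) + 1\<close>, which ranges over all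
  integers \<open>N \<ge> 2\<close>; a point \<open>(x\<^sub>1, x')\<close> has \<open>x' = (x\<^sub>2, \<dots>, x\<^sub>N)\<close>, and the norm of the product
  type is the Euclidean one.
\<close>

abbreviation half_space :: "(real \<times> (real ^ 'm)) set" where
  "half_space \<equiv> {0<..} \<times> UNIV"

end

theory Submission
  imports Defs
begin

text \<open>
  Let \<open>m\<close> be the limit of \<open>inf u\<close> over the half-spaces \<open>x\<^sub>1 > a\<close> as \<open>a \<rightarrow> \<infinity>\<close>. Touching \<open>u\<close> from below
  with paraboloids gives \<open>f m = 0\<close>, so \<open>f s \<ge> \<delta> (s - m)\<close> just above \<open>m\<close>. This linear lower bound turns a
  sufficiently wide and low Gaussian bump above \<open>m\<close> into a strict subsolution. Since the equation is
  translation invariant, a bump placed below \<open>u\<close> at one point far from the boundary can be slid to any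
  other such point without touching \<open>u\<close>. If \<open>u\<close> did not tend uniformly to \<open>m\<close>, a Gaussian barrier
  (a weak Harnack inequality) would make room for a bump, and sliding it would give
  \<open>u \<ge> m + const > m\<close> far from the boundary, against the choice of \<open>m\<close>. Sliding a bump above \<open>0\<close> gives
  \<open>m > 0\<close> in the same way. The derivatives follow from interior estimates for the Laplacian, all of
  which come from the maximum principle.
\<close>

section \<open>The Laplacian along the coordinate axes and the maximum principle\<close>

text \<open>The half-space is unbounded, so infima of \<open>u\<close> need not be attained, and
  passing to a limit of translates would call for compactness in C^2. Every comparison is therefore
  made on a ball or a cube against an explicit function.

  Far from the boundary only u \<ge> m - \<eta> is known, never u \<ge> m. This is why the bump is
  cut off at the level exp (-N) but followed until \<alpha> |x - y|^2 is at least N + 1: there it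
  lies below m by a fixed multiple of \<epsilon>, which is the room for \<eta>. The linear growth of
  \<open>f\<close> is used only above m. Below m, f \<ge> 0 suffices because the Gaussian is
  strictly subharmonic there, its Laplacian having the sign of 2 \<alpha> |x - y|^2 - N.

  As \<open>f\<close> is merely Lipschitz, the equation cannot be differentiated. The difference
  quotients of \<open>u\<close> still have bounded Laplacian, and such functions have gradients with
  every Hoelder exponent below 1, which is exactly the range of \<beta>. All estimates are linear in
  the supremum of |u - z| because f z = 0, so uniform convergence carries over to the full
  norm.\<close>

text \<open>Only the pure second derivatives are required, and without continuity; this class is
  stable under the reflections and difference operators applied to the solution.\<close>

definition has_lap :: "'a::euclidean_space set \<Rightarrow> ('a \<Rightarrow> real) \<Rightarrow> ('a \<Rightarrow> real) \<Rightarrow> bool" where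
  "has_lap S w l \<longleftrightarrow> continuous_on S w \<and>
    (\<exists>w1 w2. (\<forall>b\<in>Basis. \<forall>x\<in>S.
        ((\<lambda>t. w (x + t *\<^sub>R b)) has_real_derivative w1 b x) (at 0) \<and>
        ((\<lambda>t. w1 b (x + t *\<^sub>R b)) has_real_derivative w2 b x) (at 0)) \<and>
      (\<forall>x\<in>S. l x = (\<Sum>b\<in>Basis. w2 b x)))"

lemma has_lapI:
  assumes "continuous_on S w"
    and "\<And>b x. b \<in> Basis \<Longrightarrow> x \<in> S \<Longrightarrow> ((\<lambda>t. w (x + t *\<^sub>R b)) has_real_derivative w1 b x) (at 0)"
    and "\<And>b x. b \<in> Basis \<Longrightarrow> x \<in> S \<Longrightarrow> ((\<lambda>t. w1 b (x + t *\<^sub>R b)) has_real_derivative w2 b x) (at 0)"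
    and "\<And>x. x \<in> S \<Longrightarrow> l x = (\<Sum>b\<in>Basis. w2 b x)"
  shows "has_lap S w l"
  unfolding has_lap_def
  proof (rule conjI[OF assms(1)], rule exI[of _ w1], rule exI[of _ w2], intro conjI ballI)
qed (fact assms)+

lemma has_lapE:
  assumes "has_lap S w l"
  obtains w1 w2 where "continuous_on S w"
    and "\<And>b x. b \<in> Basis \<Longrightarrow> x \<in> S \<Longrightarrow> ((\<lambda>t. w (x + t *\<^sub>R b)) has_real_derivative w1 b x) (at 0)"
    and "\<And>b x. b \<in> Basis \<Longrightarrow> x \<in> S \<Longrightarrow> ((\<lambda>t. w1 b (x + t *\<^sub>R b)) has_real_derivative w2 b x) (at 0)"
    and "\<And>x. x \<in> S \<Longrightarrow> l x = (\<Sum>b\<in>Basis. w2 b x)"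
proof -
  from assms obtain w1 w2 where "continuous_on S w"
    "\<forall>b\<in>Basis. \<forall>x\<in>S.
        ((\<lambda>t. w (x + t *\<^sub>R b)) has_real_derivative w1 b x) (at 0) \<and>
        ((\<lambda>t. w1 b (x + t *\<^sub>R b)) has_real_derivative w2 b x) (at 0)"
    "\<forall>x\<in>S. l x = (\<Sum>b\<in>Basis. w2 b x)"
    unfolding has_lap_def by blast
  then show thesis by (intro that[of w1 w2]) auto
qed

lemma has_lap_continuous_on: "has_lap S w l \<Longrightarrow> continuous_on S w"
  by (simp add: has_lap_def)

lemma has_lap_partial:
  assumes "has_lap S w l" "x \<in> S" "b \<in> Basis"
  shows "((\<lambda>t. w (x + t *\<^sub>R b)) has_real_derivative partial b w x) (at 0)"
proof -
  from assms(1) obtain w1 w2 where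
    "\<And>b x. b \<in> Basis \<Longrightarrow> x \<in> S \<Longrightarrow> ((\<lambda>t. w (x + t *\<^sub>R b)) has_real_derivative w1 b x) (at 0)"
    by (rule has_lapE) blast
  then have D: "((\<lambda>t. w (x + t *\<^sub>R b)) has_real_derivative w1 b x) (at 0)"
    using assms by blast
  then show ?thesis
    unfolding partial_def using DERIV_imp_deriv[OF D] D by simp
qed

text \<open>Moves the base point along the line into the parameter, the form in which the mean value
  theorem is applied to restrictions to lines.\<close>

lemma DERIV_line_shift:
  fixes b :: "'a::real_vector"
  assumes "((\<lambda>t. w ((x + s *\<^sub>R b) + t *\<^sub>R b)) has_real_derivative D) (at 0)"
  shows "((\<lambda>t. w (x + t *\<^sub>R b)) has_real_derivative D) (at s)"
proof -
  have "((\<lambda>t. w (x + (s + t) *\<^sub>R b)) has_real_derivative D) (at 0)"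
    using assms by (simp add: scaleR_add_left add.assoc)
  then have "((\<lambda>t. w (x + (t + s) *\<^sub>R b)) has_real_derivative D) (at 0)"
    by (simp add: add.commute)
  then show ?thesis
    using DERIV_shift[of "\<lambda>t. w (x + t *\<^sub>R b)" D 0 s] by simp
qed

lemma has_lap_partial_at:
  assumes "has_lap S w l" "x + s *\<^sub>R b \<in> S" "b \<in> Basis"
  shows "((\<lambda>t. w (x + t *\<^sub>R b)) has_real_derivative partial b w (x + s *\<^sub>R b)) (at s)"
  by (rule DERIV_line_shift, rule has_lap_partial[OF assms])

lemma C2_on_has_lap:
  assumes "C2_on S w"
  shows "has_lap S w (laplacian w)"
proof (rule has_lapI)
  have *: "((\<lambda>t. w (x + t *\<^sub>R b)) has_real_derivative partial b w x) (at 0)"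
    if "has_partial b w x" for w :: "'a \<Rightarrow> real" and b x
    using that unfolding has_partial_def partial_def by (simp add: DERIV_deriv_iff_real_differentiable)
  show "continuous_on S w" using assms by (simp add: C2_on_def)
  show "((\<lambda>t. w (x + t *\<^sub>R b)) has_real_derivative partial b w x) (at 0)"
    "((\<lambda>t. partial b w (x + t *\<^sub>R b)) has_real_derivative partial b (partial b w) x) (at 0)"
    if "b \<in> Basis" "x \<in> S" for b x
    using assms that by (auto simp: C2_on_def intro!: *)
qed (simp add: laplacian_def)

section \<open>Closure properties of the class \<open>has_lap\<close>\<close>

lemma has_lap_cong:
  assumes "has_lap S w l" "\<And>x. x \<in> S \<Longrightarrow> l x = l' x"
  shows "has_lap S w l'"
  using assms by (simp add: has_lap_def)

lemma has_lap_subset: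
  assumes "has_lap S w l" "T \<subseteq> S"
  shows "has_lap T w l"
proof -
  from assms(1) obtain w1 w2 where *: "continuous_on S w"
    "\<And>b x. b \<in> Basis \<Longrightarrow> x \<in> S \<Longrightarrow> ((\<lambda>t. w (x + t *\<^sub>R b)) has_real_derivative w1 b x) (at 0)"
    "\<And>b x. b \<in> Basis \<Longrightarrow> x \<in> S \<Longrightarrow> ((\<lambda>t. w1 b (x + t *\<^sub>R b)) has_real_derivative w2 b x) (at 0)"
    "\<And>x. x \<in> S \<Longrightarrow> l x = (\<Sum>b\<in>Basis. w2 b x)"
    by (rule has_lapE) blast
  show ?thesis
    by (rule has_lapI[of _ _ w1 w2]) (use * assms(2) in \<open>auto intro: continuous_on_subset\<close>)
qed

lemma has_lap_const: "has_lap S (\<lambda>x. c) (\<lambda>x. 0)"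
  by (rule has_lapI[of _ _ "\<lambda>_ _. 0" "\<lambda>_ _. 0"]) auto

lemma has_lap_add:
  assumes "has_lap S v k" "has_lap S w l"
  shows "has_lap S (\<lambda>x. v x + w x) (\<lambda>x. k x + l x)"
proof -
  from assms(1) obtain v1 v2 where v: "continuous_on S v"
    "\<And>b x. b \<in> Basis \<Longrightarrow> x \<in> S \<Longrightarrow> ((\<lambda>t. v (x + t *\<^sub>R b)) has_real_derivative v1 b x) (at 0)"
    "\<And>b x. b \<in> Basis \<Longrightarrow> x \<in> S \<Longrightarrow> ((\<lambda>t. v1 b (x + t *\<^sub>R b)) has_real_derivative v2 b x) (at 0)"
    "\<And>x. x \<in> S \<Longrightarrow> k x = (\<Sum>b\<in>Basis. v2 b x)"
    by (rule has_lapE) blast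
  from assms(2) obtain w1 w2 where w: "continuous_on S w"
    "\<And>b x. b \<in> Basis \<Longrightarrow> x \<in> S \<Longrightarrow> ((\<lambda>t. w (x + t *\<^sub>R b)) has_real_derivative w1 b x) (at 0)"
    "\<And>b x. b \<in> Basis \<Longrightarrow> x \<in> S \<Longrightarrow> ((\<lambda>t. w1 b (x + t *\<^sub>R b)) has_real_derivative w2 b x) (at 0)"
    "\<And>x. x \<in> S \<Longrightarrow> l x = (\<Sum>b\<in>Basis. w2 b x)"
    by (rule has_lapE) blast
  show ?thesis
    by (rule has_lapI[of _ _ "\<lambda>b x. v1 b x + w1 b x" "\<lambda>b x. v2 b x + w2 b x"])
      (simp_all add: v w continuous_on_add DERIV_add sum.distrib)
qed

lemma has_lap_cmult:
  assumes "has_lap S w l"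
  shows "has_lap S (\<lambda>x. c * w x) (\<lambda>x. c * l x)"
proof -
  from assms(1) obtain w1 w2 where w: "continuous_on S w"
    "\<And>b x. b \<in> Basis \<Longrightarrow> x \<in> S \<Longrightarrow> ((\<lambda>t. w (x + t *\<^sub>R b)) has_real_derivative w1 b x) (at 0)"
    "\<And>b x. b \<in> Basis \<Longrightarrow> x \<in> S \<Longrightarrow> ((\<lambda>t. w1 b (x + t *\<^sub>R b)) has_real_derivative w2 b x) (at 0)"
    "\<And>x. x \<in> S \<Longrightarrow> l x = (\<Sum>b\<in>Basis. w2 b x)"
    by (rule has_lapE) blast
  show ?thesis
    by (rule has_lapI[of _ _ "\<lambda>b x. c * w1 b x" "\<lambda>b x. c * w2 b x"])
      (simp_all add: w continuous_on_mult_left DERIV_cmult sum_distrib_left)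
qed

lemma has_lap_diff:
  assumes "has_lap S v k" "has_lap S w l"
  shows "has_lap S (\<lambda>x. v x - w x) (\<lambda>x. k x - l x)"
  using has_lap_add[OF assms(1) has_lap_cmult[OF assms(2), of "-1"]] by simp

lemma has_lap_shift:
  assumes "has_lap S w l" "\<And>x. x \<in> T \<Longrightarrow> x + s \<in> S"
  shows "has_lap T (\<lambda>x. w (x + s)) (\<lambda>x. l (x + s))"
proof -
  from assms(1) obtain w1 w2 where w: "continuous_on S w"
    "\<And>b x. b \<in> Basis \<Longrightarrow> x \<in> S \<Longrightarrow> ((\<lambda>t. w (x + t *\<^sub>R b)) has_real_derivative w1 b x) (at 0)"
    "\<And>b x. b \<in> Basis \<Longrightarrow> x \<in> S \<Longrightarrow> ((\<lambda>t. w1 b (x + t *\<^sub>R b)) has_real_derivative w2 b x) (at 0)"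
    "\<And>x. x \<in> S \<Longrightarrow> l x = (\<Sum>b\<in>Basis. w2 b x)"
    by (rule has_lapE) blast
  have eq: "x + t *\<^sub>R b + s = (x + s) + t *\<^sub>R b" for x b and t :: real by (simp add: algebra_simps)
  show ?thesis
  proof (rule has_lapI[of _ _ "\<lambda>b x. w1 b (x + s)" "\<lambda>b x. w2 b (x + s)"])
    show "continuous_on T (\<lambda>x. w (x + s))"
      by (rule continuous_on_compose2[OF w(1)]) (use assms(2) in \<open>auto intro!: continuous_intros\<close>)
  qed (unfold eq, use w assms(2) in auto)
qed

text \<open>For a unit vector \<open>b\<close> this is the reflection in the hyperplane through
  \<open>p\<close> orthogonal to \<open>b\<close>. For a basis vector it flips a single coordinate
  and so respects derivatives along the axes.\<close>

definition refl_at :: "'a::euclidean_space \<Rightarrow> 'a \<Rightarrow> 'a \<Rightarrow> 'a" where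
  "refl_at p b x = x - (2 * ((x - p) \<bullet> b)) *\<^sub>R b"

lemma has_lap_refl_at:
  assumes "has_lap S w l" "b \<in> Basis" "\<And>x. x \<in> T \<Longrightarrow> refl_at p b x \<in> S"
  shows "has_lap T (\<lambda>x. w (refl_at p b x)) (\<lambda>x. l (refl_at p b x))"
proof -
  from assms(1) obtain w1 w2 where w: "continuous_on S w"
    "\<And>b x. b \<in> Basis \<Longrightarrow> x \<in> S \<Longrightarrow> ((\<lambda>t. w (x + t *\<^sub>R b)) has_real_derivative w1 b x) (at 0)"
    "\<And>b x. b \<in> Basis \<Longrightarrow> x \<in> S \<Longrightarrow> ((\<lambda>t. w1 b (x + t *\<^sub>R b)) has_real_derivative w2 b x) (at 0)"
    "\<And>x. x \<in> S \<Longrightarrow> l x = (\<Sum>b\<in>Basis. w2 b x)"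
    by (rule has_lapE) blast
  \<comment> \<open>The sign picked up along the axis \<open>c\<close>: it enters a first derivative
    once and a second derivative squared, hence not at all.\<close>
  define g where "g c = (if c = b then -1 else (1::real))" for c
  have eq: "refl_at p b (x + t *\<^sub>R c) = refl_at p b x + (g c * t) *\<^sub>R c" if "c \<in> Basis" for x c and t :: real
  proof (cases "c = b")
    case True
    have "(2 * ((x - p) \<bullet> b + t)) *\<^sub>R b = (2 * ((x - p) \<bullet> b)) *\<^sub>R b + t *\<^sub>R b + t *\<^sub>R b"
      by (simp flip: scaleR_add_left)
    moreover have "(x + t *\<^sub>R b - p) \<bullet> b = (x - p) \<bullet> b + t"
      using assms(2) by (simp add: inner_diff_left inner_add_left)
    ultimately show ?thesis using True by (simp add: refl_at_def g_def)
  next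
    case False
    then have "(x + t *\<^sub>R c - p) \<bullet> b = (x - p) \<bullet> b"
      using assms(2) that by (simp add: inner_diff_left inner_add_left inner_Basis)
    then show ?thesis using False by (simp add: refl_at_def g_def)
  qed
  have D: "((\<lambda>t. v (y + (g c * t) *\<^sub>R c)) has_real_derivative D * g c) (at 0)"
    if "((\<lambda>t. v (y + t *\<^sub>R c)) has_real_derivative D) (at 0)" for v c D and y :: 'a
    using DERIV_chain2[of "\<lambda>t. v (y + t *\<^sub>R c)" D "\<lambda>t. g c * t" 0 "g c" UNIV] that
    by (auto intro!: derivative_eq_intros)
  show ?thesis
  proof (rule has_lapI[of _ _ "\<lambda>c x. w1 c (refl_at p b x) * g c" "\<lambda>c x. w2 c (refl_at p b x)"])
    show "continuous_on T (\<lambda>x. w (refl_at p b x))"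
      by (rule continuous_on_compose2[OF w(1)])
        (use assms(3) in \<open>auto intro!: continuous_intros simp: refl_at_def\<close>)
    show "((\<lambda>t. w (refl_at p b (x + t *\<^sub>R c))) has_real_derivative w1 c (refl_at p b x) * g c) (at 0)"
      if "c \<in> Basis" "x \<in> T" for c x
      unfolding eq[OF that(1)] by (rule D) (use w(2) that assms(3) in auto)
    show "((\<lambda>t. w1 c (refl_at p b (x + t *\<^sub>R c)) * g c) has_real_derivative w2 c (refl_at p b x)) (at 0)"
      if "c \<in> Basis" "x \<in> T" for c x
    proof -
      have "((\<lambda>t. w1 c (refl_at p b x + (g c * t) *\<^sub>R c) * g c) has_real_derivative
          (w2 c (refl_at p b x) * g c) * g c) (at 0)"
        by (intro DERIV_cmult_right D w(3)) (use that assms(3) in auto)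
      moreover have "g c * g c = 1" by (simp add: g_def)
      ultimately show ?thesis unfolding eq[OF that(1)] by (simp add: mult.assoc)
    qed
  qed (use w assms(3) in auto)
qed

section \<open>Explicit barriers: quadratics and Gaussians\<close>

lemma has_lap_quadratic:
  fixes p b :: "'a::euclidean_space" and A B C :: real
  assumes "b \<in> Basis"
  shows "has_lap S (\<lambda>x. A * ((x - p) \<bullet> (x - p)) + B * ((x - p) \<bullet> b) + C * ((x - p) \<bullet> b)\<^sup>2)
    (\<lambda>x. 2 * DIM('a) * A + 2 * C)"
proof (rule has_lapI[of _ _ "\<lambda>c x. 2 * A * ((x - p) \<bullet> c) + (B + 2 * C * ((x - p) \<bullet> b)) * (c \<bullet> b)"
      "\<lambda>c x. 2 * A + 2 * C * (c \<bullet> b)"])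
  have eq: "x + t *\<^sub>R c - p = (x - p) + t *\<^sub>R c" for x c and t :: real by simp
  show "((\<lambda>t. A * ((x + t *\<^sub>R c - p) \<bullet> (x + t *\<^sub>R c - p)) + B * ((x + t *\<^sub>R c - p) \<bullet> b)
      + C * ((x + t *\<^sub>R c - p) \<bullet> b)\<^sup>2) has_real_derivative
      2 * A * ((x - p) \<bullet> c) + (B + 2 * C * ((x - p) \<bullet> b)) * (c \<bullet> b)) (at 0)" for c x
    unfolding eq inner_add_left inner_add_right inner_scaleR_left inner_scaleR_right
    by (rule derivative_eq_intros refl)+ (simp add: inner_commute algebra_simps)
  show "((\<lambda>t. 2 * A * ((x + t *\<^sub>R c - p) \<bullet> c) + (B + 2 * C * ((x + t *\<^sub>R c - p) \<bullet> b)) * (c \<bullet> b))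
      has_real_derivative 2 * A + 2 * C * (c \<bullet> b)) (at 0)" if "c \<in> Basis" for c x
    using that assms unfolding eq inner_add_left inner_add_right inner_scaleR_left inner_scaleR_right
    by (auto intro!: derivative_eq_intros simp: inner_Basis)
  show "2 * DIM('a) * A + 2 * C = (\<Sum>c\<in>Basis. 2 * A + 2 * C * (c \<bullet> b))"
    using assms by (simp add: sum.distrib inner_Basis flip: sum_distrib_left)
qed (intro continuous_intros)

text \<open>The Laplacian changes sign where \<alpha> |x - p|^2 is half the dimension. Outside that
  sphere the Gaussian is strictly subharmonic, which serves both the barrier and the bump.\<close>

lemma has_lap_gaussian:
  fixes p :: "'a::euclidean_space"
  shows "has_lap S (\<lambda>x. exp (- \<alpha> * ((x - p) \<bullet> (x - p))))
    (\<lambda>x. (4 * \<alpha>\<^sup>2 * ((x - p) \<bullet> (x - p)) - 2 * \<alpha> * DIM('a)) * exp (- \<alpha> * ((x - p) \<bullet> (x - p))))"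
proof (rule has_lapI[of _ _ "\<lambda>b x. - 2 * \<alpha> * ((x - p) \<bullet> b) * exp (- \<alpha> * ((x - p) \<bullet> (x - p)))"
      "\<lambda>b x. (4 * \<alpha>\<^sup>2 * ((x - p) \<bullet> b)\<^sup>2 - 2 * \<alpha>) * exp (- \<alpha> * ((x - p) \<bullet> (x - p)))"])
  have eq: "x + t *\<^sub>R c - p = (x - p) + t *\<^sub>R c" for x c and t :: real by simp
  have D: "((\<lambda>t. exp (- \<alpha> * ((x + t *\<^sub>R b - p) \<bullet> (x + t *\<^sub>R b - p)))) has_real_derivative
      - 2 * \<alpha> * ((x - p) \<bullet> b) * exp (- \<alpha> * ((x - p) \<bullet> (x - p)))) (at 0)"
    if "b \<in> Basis" for b x
  proof -
    have "((\<lambda>t. - \<alpha> * ((x + t *\<^sub>R b - p) \<bullet> (x + t *\<^sub>R b - p))) has_real_derivative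
        - 2 * \<alpha> * ((x - p) \<bullet> b)) (at 0)"
      unfolding eq inner_add_left inner_add_right inner_scaleR_left inner_scaleR_right
      by (rule derivative_eq_intros refl)+ (simp add: inner_commute algebra_simps)
    from DERIV_fun_exp[OF this] show ?thesis by (simp add: mult.commute)
  qed
  then show "((\<lambda>t. exp (- \<alpha> * ((x + t *\<^sub>R b - p) \<bullet> (x + t *\<^sub>R b - p)))) has_real_derivative
      - 2 * \<alpha> * ((x - p) \<bullet> b) * exp (- \<alpha> * ((x - p) \<bullet> (x - p)))) (at 0)"
    if "b \<in> Basis" for b x using that .
  show "((\<lambda>t. - 2 * \<alpha> * ((x + t *\<^sub>R b - p) \<bullet> b) * exp (- \<alpha> * ((x + t *\<^sub>R b - p) \<bullet> (x + t *\<^sub>R b - p)))) has_real_derivative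
      (4 * \<alpha>\<^sup>2 * ((x - p) \<bullet> b)\<^sup>2 - 2 * \<alpha>) * exp (- \<alpha> * ((x - p) \<bullet> (x - p)))) (at 0)"
    if "b \<in> Basis" for b x
  proof -
    have "((\<lambda>t. - 2 * \<alpha> * ((x + t *\<^sub>R b - p) \<bullet> b)) has_real_derivative - 2 * \<alpha>) (at 0)"
      using that unfolding eq inner_add_left inner_scaleR_left
      by (auto intro!: derivative_eq_intros simp: inner_Basis)
    from DERIV_mult[OF this D[OF that, of x]] show ?thesis
      by (rule DERIV_cong) (simp add: algebra_simps power2_eq_square)
  qed
  show "(4 * \<alpha>\<^sup>2 * ((x - p) \<bullet> (x - p)) - 2 * \<alpha> * real DIM('a)) * exp (- \<alpha> * ((x - p) \<bullet> (x - p))) =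
    (\<Sum>b\<in>Basis. (4 * \<alpha>\<^sup>2 * ((x - p) \<bullet> b)\<^sup>2 - 2 * \<alpha>) * exp (- \<alpha> * ((x - p) \<bullet> (x - p))))" for x
    unfolding sum_distrib_right[symmetric] sum_subtractf sum_distrib_left[symmetric]
      euclidean_inner[of "x - p" "x - p"] by (simp add: power2_eq_square)
qed (intro continuous_intros)

section \<open>The minimum principle\<close>

text \<open>Only differentiability of \<open>g'\<close> at 0 is at hand. If \<open>D\<close> were
  negative, \<open>g'\<close> would be negative just to the right of 0, and the mean value theorem
  would push \<open>g\<close> below \<open>g 0\<close>.\<close>

lemma second_derivative_local_min:
  fixes g :: "real \<Rightarrow> real"
  assumes r: "0 < r" and g: "\<And>t. \<bar>t\<bar> < r \<Longrightarrow> (g has_real_derivative g' t) (at t)"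
    and g': "(g' has_real_derivative D) (at 0)" and le: "\<And>t. \<bar>t\<bar> < r \<Longrightarrow> g 0 \<le> g t"
  shows "0 \<le> D"
proof (rule ccontr)
  assume "\<not> 0 \<le> D"
  then have D: "D < 0" by simp
  have 0: "g' 0 = 0"
    by (rule DERIV_local_min[OF g[of 0] r]) (use r le in auto)
  from DERIV_neg_dec_right[OF g' D] obtain d where d: "d > 0" "\<And>h. h > 0 \<Longrightarrow> h < d \<Longrightarrow> g' h < g' 0"
    by auto
  define s where "s = min r d / 2"
  have s: "0 < s" "s < r" "s < d" using r d(1) by (auto simp: s_def)
  have "\<exists>z. z > 0 \<and> z < s \<and> g s - g 0 = (s - 0) * g' z"
    by (rule MVT2) (use s g in auto)
  then obtain z where z: "0 < z" "z < s" "g s - g 0 = s * g' z" by auto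
  have "g' z < 0" using d(2)[of z] z s 0 by auto
  then have "s * g' z < 0" using s by (simp add: mult_pos_neg)
  then have "g s < g 0" using z by simp
  then show False using le[of s] s by auto
qed

lemma has_lap_local_min:
  assumes w: "has_lap S w l" and "open S" "x \<in> S" and min: "\<And>y. y \<in> S \<Longrightarrow> w x \<le> w y"
  shows "0 \<le> l x"
proof -
  from w obtain w1 w2 where
    1: "\<And>b x. b \<in> Basis \<Longrightarrow> x \<in> S \<Longrightarrow> ((\<lambda>t. w (x + t *\<^sub>R b)) has_real_derivative w1 b x) (at 0)"
    and 2: "\<And>b x. b \<in> Basis \<Longrightarrow> x \<in> S \<Longrightarrow> ((\<lambda>t. w1 b (x + t *\<^sub>R b)) has_real_derivative w2 b x) (at 0)"
    and l: "\<And>x. x \<in> S \<Longrightarrow> l x = (\<Sum>b\<in>Basis. w2 b x)"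
    by (rule has_lapE) blast
  from assms obtain r where r: "r > 0" "ball x r \<subseteq> S" using open_contains_ball by blast
  have "0 \<le> w2 b x" if b: "b \<in> Basis" for b
  proof (rule second_derivative_local_min[OF r(1), of "\<lambda>t. w (x + t *\<^sub>R b)" "\<lambda>t. w1 b (x + t *\<^sub>R b)"])
    have in_S: "x + t *\<^sub>R b \<in> S" if "\<bar>t\<bar> < r" for t
      using that r b by (intro subsetD[OF r(2)]) (simp add: dist_norm)
    show "((\<lambda>t. w (x + t *\<^sub>R b)) has_real_derivative w1 b (x + t *\<^sub>R b)) (at t)" if "\<bar>t\<bar> < r" for t
      by (rule DERIV_line_shift, rule 1[OF b in_S[OF that]])
    show "w (x + 0 *\<^sub>R b) \<le> w (x + t *\<^sub>R b)" if "\<bar>t\<bar> < r" for t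
      using min in_S[OF that] by simp
  qed (use 2[OF b \<open>x \<in> S\<close>] in simp)
  then show ?thesis using l[OF \<open>x \<in> S\<close>] by (simp add: sum_nonneg)
qed

text \<open>A violation would produce an interior minimum with value below \<open>c\<close>, so the
  sign of \<open>l\<close> is demanded only where \<open>w\<close> is below \<open>c\<close>. This
  lets a nonlinear term be estimated just where the value of the solution is under control.\<close>

lemma has_lap_min_on_compact:
  assumes w: "has_lap U w l" and U: "open U" "U \<subseteq> K" and K: "compact K" "continuous_on K w"
    and neg: "\<And>x. x \<in> U \<Longrightarrow> w x < c \<Longrightarrow> l x < 0" and bd: "\<And>x. x \<in> K - U \<Longrightarrow> c \<le> w x" and x: "x \<in> K"
  shows "c \<le> w x"
proof (rule ccontr)
  assume "\<not> c \<le> w x"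
  moreover obtain y where y: "y \<in> K" "\<And>z. z \<in> K \<Longrightarrow> w y \<le> w z"
    using continuous_attains_inf[OF K(1) _ K(2)] x by auto
  ultimately have "w y < c" using x by (meson not_le order_trans)
  then have yU: "y \<in> U" using bd[of y] y(1) by force
  have "0 \<le> l y"
    by (rule has_lap_local_min[OF w U(1) yU]) (use y(2) U(2) in auto)
  then show False using neg[OF yU \<open>w y < c\<close>] by simp
qed

section \<open>Interior derivative estimates\<close>

text \<open>Compare the odd part of \<open>v\<close> under reflection at \<open>p\<close> in direction \<open>b\<close>, which vanishes on the
  hyperplane through \<open>p\<close>, with a quadratic barrier \<open>\<psi>\<close> on half of the cube.\<close>

lemma gradient_bound_one_sided:
  fixes v :: "'a::euclidean_space \<Rightarrow> real" and M G d :: real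
  assumes v: "has_lap S v l" and b: "b \<in> Basis" and d: "0 < d" and G: "0 < G"
    and S: "\<And>x. (\<And>c. c \<in> Basis \<Longrightarrow> \<bar>(x - p) \<bullet> c\<bar> \<le> d) \<Longrightarrow> x \<in> S"
    and M: "\<And>x. (\<And>c. c \<in> Basis \<Longrightarrow> \<bar>(x - p) \<bullet> c\<bar> \<le> d) \<Longrightarrow> \<bar>v x\<bar> \<le> M"
    and l: "\<And>x. (\<And>c. c \<in> Basis \<Longrightarrow> \<bar>(x - p) \<bullet> c\<bar> \<le> d) \<Longrightarrow> \<bar>l x\<bar> \<le> G"
  shows "partial b v p \<le> DIM('a) * M / d + d * G"
proof -
  define N where "N = real DIM('a)"
  define K where "K = cbox (p - d *\<^sub>R One) (p + d *\<^sub>R One)"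
  define Q where "Q = K \<inter> {x. p \<bullet> b \<le> x \<bullet> b}"
  define U where "U = box (p - d *\<^sub>R One) (p + d *\<^sub>R One) \<inter> {x. p \<bullet> b < x \<bullet> b}"
  define R where "R = refl_at p b"
  define q where "q = M / d\<^sup>2"
  \<comment> \<open>With y = (x - p) \<bullet> b this is q |x - p|^2 + (N q + G) y (d - y). Its
    Laplacian is -2 G, it is nonnegative on y = 0 and at least q d^2 = M on the other faces, and its
    slope at \<open>p\<close> along \<open>b\<close> is (N q + G) d, the bound to be proved.\<close>
  define \<psi> where "\<psi> x = q * ((x - p) \<bullet> (x - p)) + (N * q * d + G * d) * ((x - p) \<bullet> b)
      + (- (N * q) - G) * ((x - p) \<bullet> b)\<^sup>2" for x
  define W where "W x = 2 * \<psi> x - (v x - v (R x))" for x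
  have K_iff: "x \<in> K \<longleftrightarrow> (\<forall>c\<in>Basis. \<bar>(x - p) \<bullet> c\<bar> \<le> d)" for x
    by (auto simp: K_def mem_box inner_simps abs_le_iff)
  have U_iff: "x \<in> U \<longleftrightarrow> (\<forall>c\<in>Basis. \<bar>(x - p) \<bullet> c\<bar> < d) \<and> 0 < (x - p) \<bullet> b" for x
    by (auto simp: U_def mem_box inner_simps abs_less_iff)
  have Q_iff: "x \<in> Q \<longleftrightarrow> x \<in> K \<and> 0 \<le> (x - p) \<bullet> b" for x
    by (auto simp: Q_def inner_simps)
  have KS: "x \<in> S" "\<bar>v x\<bar> \<le> M" "\<bar>l x\<bar> \<le> G" if "x \<in> K" for x
    using that S[of x] M[of x] l[of x] unfolding K_iff by blast+
  have "0 \<le> M" using KS(2)[of p] d by (force simp: K_iff)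
  then have q0: "0 \<le> q" by (simp add: q_def)
  have qd: "q * d\<^sup>2 = M" using d by (simp add: q_def)
  have RK: "R x \<in> K" if "x \<in> K" for x
    using that b unfolding K_iff R_def refl_at_def
    by (auto simp: inner_diff_left inner_Basis algebra_simps split: if_splits)
  have UQ: "U \<subseteq> Q"
  proof
    fix x assume "x \<in> U"
    then have "\<bar>(x - p) \<bullet> c\<bar> \<le> d" if "c \<in> Basis" for c
      using that U_iff[of x] less_imp_le by blast
    moreover have "0 \<le> (x - p) \<bullet> b" using \<open>x \<in> U\<close> U_iff[of x] by linarith
    ultimately show "x \<in> Q" using Q_iff K_iff by blast
  qed
  have "has_lap S \<psi> (\<lambda>x. - 2 * G)" for S
    unfolding \<psi>_def
    by (rule has_lap_cong[OF has_lap_quadratic[OF b]]) (simp add: N_def algebra_simps)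
  moreover have "has_lap Q (\<lambda>x. v (R x)) (\<lambda>x. l (R x))"
    unfolding R_def by (rule has_lap_refl_at[OF v b]) (use RK KS(1) Q_iff R_def in auto)
  moreover have "has_lap Q v l"
    by (rule has_lap_subset[OF v]) (use KS(1) Q_iff in auto)
  ultimately have W: "has_lap Q W (\<lambda>x. 2 * (- 2 * G) - (l x - l (R x)))"
    unfolding W_def by (intro has_lap_diff has_lap_cmult)
  have W0: "0 \<le> W x" if x: "x \<in> Q" for x
  proof (rule has_lap_min_on_compact[OF has_lap_subset[OF W UQ] _ UQ])
    show "open U" unfolding U_def by (intro open_Int open_box open_halfspace_component_gt)
    show "compact Q" unfolding Q_def K_def
      by (intro compact_Int_closed compact_cbox closed_halfspace_component_ge)
    show "continuous_on Q W" by (rule has_lap_continuous_on[OF W])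
    show "2 * (- 2 * G) - (l x - l (R x)) < 0" if "x \<in> U" for x
    proof -
      have "x \<in> K" using that UQ Q_iff by blast
      then have "\<bar>l x\<bar> \<le> G" "\<bar>l (R x)\<bar> \<le> G" using KS(3) RK by blast+
      then show ?thesis using G by linarith
    qed
    show "0 \<le> W x" if x: "x \<in> Q - U" for x
    proof (cases "(x - p) \<bullet> b = 0")
      case True
      then show ?thesis using q0 by (simp add: W_def \<psi>_def R_def refl_at_def)
    next
      case False
      have xK: "x \<in> K" and y0: "0 \<le> (x - p) \<bullet> b" using x Q_iff by auto
      obtain c where c: "c \<in> Basis" "d \<le> \<bar>(x - p) \<bullet> c\<bar>"
      proof -
        have "0 < (x - p) \<bullet> b" using y0 False by linarith
        moreover have "x \<notin> U" using x by blast
        ultimately show thesis using U_iff[of x] that by (auto simp: not_less)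
      qed
      define y where "y = (x - p) \<bullet> b"
      have "((x - p) \<bullet> c)\<^sup>2 \<le> (x - p) \<bullet> (x - p)"
        using member_le_sum[of c Basis "\<lambda>b. ((x - p) \<bullet> b) * ((x - p) \<bullet> b)"] c(1)
          euclidean_inner[of "x - p" "x - p"] by (simp add: power2_eq_square)
      moreover have "d\<^sup>2 \<le> ((x - p) \<bullet> c)\<^sup>2" using c(2) d by (metis abs_le_square_iff abs_of_pos)
      ultimately have X: "d\<^sup>2 \<le> (x - p) \<bullet> (x - p)" by simp
      have yd: "0 \<le> y" "y \<le> d" using y0 xK b unfolding K_iff y_def by auto
      have "\<psi> x = q * ((x - p) \<bullet> (x - p)) + (N * q + G) * (y * (d - y))"
        unfolding \<psi>_def y_def[symmetric] by (simp add: algebra_simps power2_eq_square)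
      moreover have "0 \<le> (N * q + G) * (y * (d - y))"
        using yd q0 G by (intro mult_nonneg_nonneg add_nonneg_nonneg) (auto simp: N_def)
      moreover have "q * d\<^sup>2 \<le> q * ((x - p) \<bullet> (x - p))"
        using X q0 by (rule mult_left_mono)
      ultimately have "M \<le> \<psi> x" using qd by simp
      then show ?thesis using KS(2)[OF xK] KS(2)[OF RK[OF xK]] by (simp add: W_def)
    qed
  qed (fact x)
  have D: "((\<lambda>t. v (p + t *\<^sub>R b)) has_real_derivative partial b v p) (at 0)"
    by (rule has_lap_partial[OF v _ b]) (use KS(1)[of p] d in \<open>auto simp: K_iff\<close>)
  have "((\<lambda>t. v (p + t *\<^sub>R b)) has_real_derivative partial b v p) (at (- 0))" using D by simp
  from DERIV_chain2[OF this DERIV_minus[OF DERIV_ident]]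
  have D': "((\<lambda>t. v (p + (- t) *\<^sub>R b)) has_real_derivative partial b v p * - 1) (at 0)" .
  have "((\<lambda>t. v (p + t *\<^sub>R b) - v (p + (- t) *\<^sub>R b)) has_real_derivative 2 * partial b v p) (at 0)"
    using DERIV_diff[OF D D'] by simp
  then have lim: "((\<lambda>t. (v (p + t *\<^sub>R b) - v (p + (- t) *\<^sub>R b)) / t) \<longlongrightarrow> 2 * partial b v p) (at_right 0)"
    unfolding DERIV_def by (auto intro: tendsto_mono[OF at_le])
  have lim': "((\<lambda>t. 2 * (q * (t + N * d) + G * d)) \<longlongrightarrow> 2 * (q * (0 + N * d) + G * d)) (at_right 0)"
    by (intro tendsto_intros)
  \<comment> \<open>Both terms of \<open>W\<close> vanish at \<open>p\<close>, so dividing 0 \<le> W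
    by t compares slopes at \<open>p\<close>; the odd part of \<open>v\<close> has slope
    \<open>2 * partial b v p\<close>.\<close>
  have "2 * partial b v p \<le> 2 * (q * (0 + N * d) + G * d)"
  proof (rule tendsto_le[OF _ lim' lim])
    have "(v (p + t *\<^sub>R b) - v (p + (- t) *\<^sub>R b)) / t \<le> 2 * (q * (t + N * d) + G * d)"
      if t: "0 < t" "t < d" for t
    proof -
      have "p + t *\<^sub>R b \<in> Q" using t b by (auto simp: Q_iff K_iff inner_Basis)
      then have "0 \<le> W (p + t *\<^sub>R b)" by (rule W0)
      moreover have "R (p + t *\<^sub>R b) = p + (- t) *\<^sub>R b"
      proof -
        have "(2 * t) *\<^sub>R b = t *\<^sub>R b + t *\<^sub>R b" by (simp flip: scaleR_add_left)
        then show ?thesis using b by (simp add: R_def refl_at_def)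
      qed
      moreover have "\<psi> (p + t *\<^sub>R b) = t * (q * (t + N * d) + G * d) - (N * q + G) * t\<^sup>2"
        using b by (simp add: \<psi>_def algebra_simps power2_eq_square)
      moreover have "0 \<le> (N * q + G) * t\<^sup>2" using q0 G by (simp add: N_def)
      ultimately have "v (p + t *\<^sub>R b) - v (p + (- t) *\<^sub>R b) \<le> 2 * (t * (q * (t + N * d) + G * d))"
        by (simp add: W_def)
      then show ?thesis using t by (simp add: pos_divide_le_eq mult_ac)
    qed
    then show "\<forall>\<^sub>F t in at_right 0. (v (p + t *\<^sub>R b) - v (p + (- t) *\<^sub>R b)) / t \<le> 2 * (q * (t + N * d) + G * d)"
      using d by (intro eventually_at_rightI[of 0 d]) auto
  qed simp
  moreover have "q * (N * d) = N * M / d" using d by (simp add: q_def power2_eq_square)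
  ultimately show ?thesis by (simp add: N_def algebra_simps)
qed

lemma gradient_bound:
  fixes v :: "'a::euclidean_space \<Rightarrow> real" and M G d :: real
  assumes v: "has_lap S v l" and b: "b \<in> Basis" and d: "0 < d" and G: "0 < G"
    and S: "\<And>x. (\<And>c. c \<in> Basis \<Longrightarrow> \<bar>(x - p) \<bullet> c\<bar> \<le> d) \<Longrightarrow> x \<in> S"
    and M: "\<And>x. (\<And>c. c \<in> Basis \<Longrightarrow> \<bar>(x - p) \<bullet> c\<bar> \<le> d) \<Longrightarrow> \<bar>v x\<bar> \<le> M"
    and l: "\<And>x. (\<And>c. c \<in> Basis \<Longrightarrow> \<bar>(x - p) \<bullet> c\<bar> \<le> d) \<Longrightarrow> \<bar>l x\<bar> \<le> G"
  shows "\<bar>partial b v p\<bar> \<le> DIM('a) * M / d + d * G"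
proof -
  have "partial b (\<lambda>x. -1 * v x) p \<le> DIM('a) * M / d + d * G"
    by (rule gradient_bound_one_sided[OF has_lap_cmult[OF v, of "-1"] b d G, of p])
      (use S M l in auto)
  moreover have "p \<in> S" using S[of p] d by simp
  then have "partial b (\<lambda>x. -1 * v x) p = - partial b v p"
    unfolding partial_def[of b "\<lambda>x. -1 * v x"]
    using DERIV_cmult[OF has_lap_partial[OF v _ b], of p "-1"] by (intro DERIV_imp_deriv) simp
  moreover have "partial b v p \<le> DIM('a) * M / d + d * G"
    by (rule gradient_bound_one_sided[OF v b d G, of p]) (use S M l in auto)
  ultimately show ?thesis by linarith
qed

section \<open>Half-spaces and paths along the axes\<close>

definition upper :: "'a::euclidean_space \<Rightarrow> real \<Rightarrow> 'a set" where
  "upper e a = {x. a < x \<bullet> e}"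

lemma open_upper: "open (upper e a)"
  unfolding upper_def by (rule open_halfspace_component_gt)

lemma upper_mono: "a \<le> b \<Longrightarrow> upper e b \<subseteq> upper e a"
  by (auto simp: upper_def)

lemma upper_add_Basis:
  assumes "e \<in> Basis" "b \<in> Basis" "x \<in> upper e a" "0 \<le> t"
  shows "x + t *\<^sub>R b \<in> upper e a"
  using assms by (auto simp: upper_def inner_simps inner_Basis)

text \<open>Coordinates are changed one at a time. Every intermediate point has the
  \<open>e\<close>-coordinate of \<open>x\<close> or of \<open>y\<close>, so the path stays in the
  half-space, and no step is longer than \<open>dist x y\<close>.\<close>

lemma upper_axis_path:
  fixes g :: "'a::euclidean_space \<Rightarrow> real" and r K :: real
  assumes e: "e \<in> Basis" and xy: "x \<in> upper e a" "y \<in> upper e a" "dist x y \<le> r"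
    and step: "\<And>z b \<tau>. z \<in> upper e a \<Longrightarrow> b \<in> Basis \<Longrightarrow> z + \<tau> *\<^sub>R b \<in> upper e a \<Longrightarrow> \<bar>\<tau>\<bar> \<le> r \<Longrightarrow>
      \<bar>g (z + \<tau> *\<^sub>R b) - g z\<bar> \<le> K"
  shows "\<bar>g y - g x\<bar> \<le> DIM('a) * K"
proof -
  define P where "P F = x + (\<Sum>b\<in>F. ((y - x) \<bullet> b) *\<^sub>R b)" for F
  have P: "P F \<in> upper e a" if "F \<subseteq> Basis" for F
  proof -
    have "finite F" by (rule finite_subset[OF that finite_Basis])
    have "(\<Sum>b\<in>F. ((y - x) \<bullet> b) *\<^sub>R b) \<bullet> e = (\<Sum>b\<in>F. if b = e then (y - x) \<bullet> b else 0)"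
      unfolding inner_sum_left using that e by (intro sum.cong) (auto simp: inner_Basis)
    also have "\<dots> = (if e \<in> F then (y - x) \<bullet> e else 0)"
      using \<open>finite F\<close> by simp
    finally show ?thesis using xy(1,2) by (auto simp: P_def upper_def inner_simps)
  qed
  have "\<bar>g (P F) - g x\<bar> \<le> card F * K" if "F \<subseteq> Basis" for F
    using finite_subset[OF that finite_Basis] that
  proof (induction F rule: finite_induct)
    case empty
    then show ?case by (simp add: P_def)
  next
    case (insert b F)
    have eq: "P (insert b F) = P F + ((y - x) \<bullet> b) *\<^sub>R b"
      using insert by (simp add: P_def)
    have "\<bar>(y - x) \<bullet> b\<bar> \<le> r"
      using Basis_le_norm[of b "y - x"] insert.prems xy(3) by (simp add: dist_norm norm_minus_commute)
    then have "\<bar>g (P F + ((y - x) \<bullet> b) *\<^sub>R b) - g (P F)\<bar> \<le> K"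
      using insert.prems P[of F] P[of "insert b F"] unfolding eq by (intro step) auto
    moreover have "\<bar>g (P F) - g x\<bar> \<le> card F * K" using insert by simp
    ultimately show ?case
      using insert(1,2) unfolding eq by (simp add: algebra_simps)
  qed
  from this[of Basis] show ?thesis
    by (simp add: P_def euclidean_representation)
qed

lemma gradient_bound_upper:
  fixes v :: "'a::euclidean_space \<Rightarrow> real" and M G d :: real
  assumes v: "has_lap (upper e a) v l" and e: "e \<in> Basis" and b: "b \<in> Basis" and d: "0 < d" and G: "0 < G"
    and M: "\<And>x. x \<in> upper e a \<Longrightarrow> \<bar>v x\<bar> \<le> M" and l: "\<And>x. x \<in> upper e a \<Longrightarrow> \<bar>l x\<bar> \<le> G"
    and p: "p \<in> upper e (a + d)"
  shows "\<bar>partial b v p\<bar> \<le> DIM('a) * M / d + d * G"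
proof -
  have "x \<in> upper e a" if "\<And>c. c \<in> Basis \<Longrightarrow> \<bar>(x - p) \<bullet> c\<bar> \<le> d" for x
    using that[OF e] p by (auto simp: upper_def inner_simps)
  then show ?thesis
    using M l by (intro gradient_bound[OF v b d G]) blast+
qed

text \<open>Marchaud's argument: with \<open>\<delta> t\<close> a first difference of step \<open>t\<close>, the hypothesis \<open>halve\<close> says that
  the second differences are \<open>O(t powr s)\<close>.\<close>

lemma powr_bound_of_halving:
  fixes \<delta> :: "real \<Rightarrow> real" and B D s :: real
  assumes s: "s < 1" and B: "0 \<le> B" and D: "0 \<le> D"
    and bound: "\<And>t. 0 < t \<Longrightarrow> \<delta> t \<le> 2 * B"
    and halve: "\<And>t. 0 < t \<Longrightarrow> t \<le> 1 \<Longrightarrow> \<delta> t \<le> \<delta> (2 * t) / 2 + D / 2 * t powr s"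
    and t: "0 < t" "t \<le> 1"
  shows "\<delta> t \<le> (4 * B + D / (1 - 2 powr (s - 1))) * t powr s"
proof -
  define q where "q = (2::real) powr (s - 1)"
  \<comment> \<open>The summand 4 B handles t > 1/2, where t powr s is at least 1/2. The other one
    handles the induction: passing from 2 t to t costs the factor q < 1 and leaves K (1 - q) \<ge> D
    for the error term.\<close>
  define K where "K = 4 * B + D / (1 - q)"
  have q: "0 < q" "q < 1" using s powr_less_mono[of "s - 1" 0 "2::real"] by (simp_all add: q_def)
  have "K * (1 - q) = 4 * B * (1 - q) + D" using q by (simp add: K_def distrib_right)
  moreover have "0 \<le> 4 * B * (1 - q)" using q B by (intro mult_nonneg_nonneg) auto
  ultimately have K: "4 * B \<le> K" "D \<le> K * (1 - q)"
    using q D by (auto simp: K_def)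
  have *: "\<forall>t. (1 / 2) ^ Suc k < t \<longrightarrow> t \<le> 1 \<longrightarrow> \<delta> t \<le> K * t powr s" for k
  proof (induction k)
    case 0
    show ?case
    proof (intro allI impI)
      fix t :: real assume t: "(1 / 2) ^ Suc 0 < t" "t \<le> 1"
      have "t powr 1 \<le> t powr s" using s t by (intro powr_mono') auto
      then have "1 / 2 \<le> t powr s" using t by simp
      then have "4 * B * (1 / 2) \<le> K * t powr s"
        using K B by (intro mult_mono) auto
      then show "\<delta> t \<le> K * t powr s" using bound[of t] t by simp
    qed
  next
    case (Suc k)
    show ?case
    proof (intro allI impI)
      fix t :: real assume t: "(1 / 2) ^ Suc (Suc k) < t" "t \<le> 1"
      show "\<delta> t \<le> K * t powr s"
      proof (cases "t \<le> 1 / 2")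
        case False
        have "(1 / 2 :: real) ^ Suc k \<le> 1 / 2" using power_decreasing[of 1 "Suc k" "1 / 2 :: real"] by simp
        then show ?thesis using Suc t False by auto
      next
        case True
        have "(0::real) < (1 / 2) ^ Suc (Suc k)" by (rule zero_less_power) simp
        then have t0: "0 < t" using t(1) by (rule less_trans)
        have "\<delta> (2 * t) \<le> K * (2 * t) powr s" using Suc t True by auto
        also have "(2 * t) powr s = 2 * q * t powr s"
          using t0 by (simp add: powr_mult q_def powr_diff)
        finally have "\<delta> t \<le> K * q * t powr s + D / 2 * t powr s"
          using halve[OF t0 t(2)] by simp
        also have "\<dots> \<le> K * q * t powr s + K * (1 - q) * t powr s"
          using K D by (intro add_left_mono mult_right_mono) auto
        finally show ?thesis by (simp add: algebra_simps)
      qed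
    qed
  qed
  obtain k where "(1 / 2) ^ k < t" using real_arch_pow_inv[OF t(1), of "1 / 2"] by auto
  moreover have "(1 / 2 :: real) ^ Suc k \<le> (1 / 2) ^ k" by (rule power_decreasing) auto
  ultimately have "(1 / 2) ^ Suc k < t" by (meson le_less_trans)
  with * t show ?thesis unfolding K_def q_def by blast
qed

lemma partial_second_difference:
  assumes v: "has_lap S v l" and c: "c \<in> Basis" and S: "x \<in> S" "x + p \<in> S" "x + q \<in> S"
  shows "partial c (\<lambda>z. v (z + p) - 2 * v (z + q) + v z) x
    = partial c v (x + p) - 2 * partial c v (x + q) + partial c v x"
proof -
  have "((\<lambda>t. v ((x + s) + t *\<^sub>R c)) has_real_derivative partial c v (x + s)) (at 0)"
    if "x + s \<in> S" for s
    by (rule has_lap_partial[OF v that c])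
  then have *: "((\<lambda>t. v (x + t *\<^sub>R c + s)) has_real_derivative partial c v (x + s)) (at 0)"
    if "x + s \<in> S" for s
    using that by (simp add: add_ac)
  have "((\<lambda>t. v (x + t *\<^sub>R c + p) - 2 * v (x + t *\<^sub>R c + q) + v (x + t *\<^sub>R c)) has_real_derivative
      partial c v (x + p) - 2 * partial c v (x + q) + partial c v x) (at 0)"
    by (intro DERIV_add DERIV_diff DERIV_cmult * S has_lap_partial[OF v _ c])
  then show ?thesis unfolding partial_def[of c "\<lambda>z. v (z + p) - 2 * v (z + q) + v z"]
    by (rule DERIV_imp_deriv)
qed

text \<open>The second difference is the increment over [0, t] of the first difference
  \<open>\<phi>\<close>, whose derivative is a first difference of \<open>partial b v\<close>. The
  mean value theorem gains the factor \<open>t\<close>.\<close>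

lemma second_difference_bound:
  assumes v: "has_lap (upper e a) v l" and e: "e \<in> Basis" and b: "b \<in> Basis" and t: "0 < t"
    and D: "\<And>y. y \<in> upper e a \<Longrightarrow> \<bar>partial b v (y + t *\<^sub>R b) - partial b v y\<bar> \<le> D"
    and x: "x \<in> upper e a"
  shows "\<bar>v (x + (2 * t) *\<^sub>R b) - 2 * v (x + t *\<^sub>R b) + v x\<bar> \<le> t * D"
proof -
  define \<phi> where "\<phi> s = v ((x + t *\<^sub>R b) + s *\<^sub>R b) - v (x + s *\<^sub>R b)" for s
  have "\<exists>s. 0 < s \<and> s < t \<and> \<phi> t - \<phi> 0 =
      (t - 0) * (partial b v ((x + t *\<^sub>R b) + s *\<^sub>R b) - partial b v (x + s *\<^sub>R b))"
    unfolding \<phi>_def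
    by (intro MVT2 t DERIV_diff has_lap_partial_at[OF v] upper_add_Basis e b x) (use t in auto)
  then obtain s where s: "0 < s" "s < t" and
    eq: "\<phi> t - \<phi> 0 = t * (partial b v ((x + t *\<^sub>R b) + s *\<^sub>R b) - partial b v (x + s *\<^sub>R b))"
    by auto
  have comm: "(x + t *\<^sub>R b) + s *\<^sub>R b = (x + s *\<^sub>R b) + t *\<^sub>R b" by simp
  have "\<bar>partial b v ((x + t *\<^sub>R b) + s *\<^sub>R b) - partial b v (x + s *\<^sub>R b)\<bar> \<le> D"
    unfolding comm using s by (intro D upper_add_Basis e b x) simp
  then have "\<bar>\<phi> t - \<phi> 0\<bar> \<le> t * D" unfolding eq abs_mult using t by (simp add: mult_left_mono)
  moreover have "x + (2 * t) *\<^sub>R b = (x + t *\<^sub>R b) + t *\<^sub>R b" by (simp flip: scaleR_add_left)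
  then have "v (x + (2 * t) *\<^sub>R b) - 2 * v (x + t *\<^sub>R b) + v x = \<phi> t - \<phi> 0" by (simp only: \<phi>_def) simp
  ultimately show ?thesis by simp
qed

text \<open>Apply the gradient bound at scale \<open>d = t powr \<gamma>'\<close> to the second difference of \<open>v\<close> with step \<open>t\<close>,
  which is \<open>O(t powr (1 + \<gamma>))\<close>: the second difference of the gradient is \<open>O(t powr \<gamma>')\<close>.
  Iterating \<open>\<gamma> \<mapsto> (1 + \<gamma>) / 2\<close> from \<open>0\<close> reaches every exponent below \<open>1\<close>.\<close>

lemma holder_gradient_step:
  fixes v l :: "'a::euclidean_space \<Rightarrow> real" and C R \<gamma> M :: real
  defines "\<gamma>' \<equiv> (1 + \<gamma>) / 2" and "N \<equiv> real DIM('a)"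
  assumes \<gamma>: "0 \<le> \<gamma>" "\<gamma> < 1" and C: "0 \<le> C" and M: "0 < M"
    and v: "has_lap (upper e a) v l" and e: "e \<in> Basis"
    and bound: "\<And>x. x \<in> upper e a \<Longrightarrow> \<bar>v x\<bar> \<le> M" "\<And>x. x \<in> upper e a \<Longrightarrow> \<bar>l x\<bar> \<le> M"
    and grad: "\<And>b x. b \<in> Basis \<Longrightarrow> x \<in> upper e a \<Longrightarrow> \<bar>partial b v x\<bar> \<le> B * M"
    and holder: "\<And>b x y. b \<in> Basis \<Longrightarrow> x \<in> upper e a \<Longrightarrow> y \<in> upper e a \<Longrightarrow> dist x y \<le> 1 \<Longrightarrow>
      \<bar>partial b v x - partial b v y\<bar> \<le> C * M * dist x y powr \<gamma>"
    and b: "c \<in> Basis" "x \<in> upper e (a + 1)" "y \<in> upper e (a + 1)" "dist x y \<le> 1"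
  shows "\<bar>partial c v x - partial c v y\<bar> \<le>
    (N * (4 * B + (N * C + 4) / (1 - 2 powr (\<gamma>' - 1)))) * M * dist x y powr \<gamma>'"
proof (cases "x = y")
  case False
  define g where "g = partial c v"
  define K where "K = 4 * (B * M) + (N * C + 4) * M / (1 - 2 powr (\<gamma>' - 1))"
  have \<gamma>': "0 < \<gamma>'" "\<gamma>' < 1" using \<gamma> by (simp_all add: \<gamma>'_def)
  have sub: "upper e (a + 1) \<subseteq> upper e a" by (rule upper_mono) simp
  have B: "0 \<le> B * M" using grad[OF b(1), of x] b(2) sub by (smt (verit) subsetD abs_ge_zero)
  have N0: "0 \<le> N" by (simp add: N_def)
  have second: "\<bar>g (z + (2 * t) *\<^sub>R b) - 2 * g (z + t *\<^sub>R b) + g z\<bar> \<le> (N * C + 4) * M * t powr \<gamma>'"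
    if t: "0 < t" "t \<le> 1" and b: "b \<in> Basis" and z: "z \<in> upper e (a + 1)" for b z t
  proof -
    define w where "w z = v (z + (2 * t) *\<^sub>R b) - 2 * v (z + t *\<^sub>R b) + v z" for z
    define k where "k z = l (z + (2 * t) *\<^sub>R b) - 2 * l (z + t *\<^sub>R b) + l z" for z
    \<comment> \<open>The gradient bound for \<open>w\<close> at distance d is of order t powr (1 +
      \<gamma>) / d + d. The two terms balance when d^2 = t powr (1 + \<gamma>), which is this
      choice.\<close>
    define d where "d = t powr \<gamma>'"
    have d: "0 < d" "d \<le> 1" using t \<gamma>' powr_mono2[of \<gamma>' t 1] by (simp_all add: d_def)
    have up: "y + s *\<^sub>R b \<in> upper e a" if "y \<in> upper e a" "0 \<le> s" for y s
      using upper_add_Basis[OF e b] that .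
    have "has_lap (upper e a) w k"
      unfolding w_def k_def using t
      by (intro has_lap_add has_lap_diff has_lap_cmult v has_lap_shift[OF v] up) auto
    moreover have "\<bar>w y\<bar> \<le> t * (C * M * t powr \<gamma>)" if "y \<in> upper e a" for y
      unfolding w_def
    proof (rule second_difference_bound[OF v e b t(1) _ that])
      fix y assume "y \<in> upper e a"
      then show "\<bar>partial b v (y + t *\<^sub>R b) - partial b v y\<bar> \<le> C * M * t powr \<gamma>"
        using holder[OF b up, of y t y] t b by (simp add: dist_norm)
    qed
    moreover have "\<bar>k y\<bar> \<le> 4 * M" if "y \<in> upper e a" for y
      using bound(2)[OF that] bound(2)[OF up[OF that, of t]] bound(2)[OF up[OF that, of "2 * t"]] t
      unfolding k_def by linarith
    moreover have "z \<in> upper e (a + d)" using z d by (auto simp: upper_def)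
    ultimately have "\<bar>partial c w z\<bar> \<le> DIM('a) * (t * (C * M * t powr \<gamma>)) / d + d * (4 * M)"
      using M d by (intro gradient_bound_upper[of e a w k]) (auto simp: e \<open>c \<in> Basis\<close>)
    also have "t * t powr \<gamma> = d * d"
    proof -
      have "t * t powr \<gamma> = t powr (1 + \<gamma>)" using t by (simp add: powr_add)
      also have "\<dots> = t powr (\<gamma>' + \<gamma>')" by (simp add: \<gamma>'_def)
      finally show ?thesis by (simp only: powr_add d_def)
    qed
    then have "DIM('a) * (t * (C * M * t powr \<gamma>)) / d = N * C * M * d"
      using d by (simp add: N_def field_simps)
    also have "N * C * M * d + d * (4 * M) = (N * C + 4) * M * d" by (simp add: algebra_simps)
    also have "partial c w z = g (z + (2 * t) *\<^sub>R b) - 2 * g (z + t *\<^sub>R b) + g z"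
      unfolding w_def g_def
      by (rule partial_second_difference[OF v \<open>c \<in> Basis\<close>]) (use up t z sub in auto)
    finally show ?thesis unfolding d_def .
  qed
  have diff: "\<bar>g (z + t *\<^sub>R b) - g z\<bar> \<le> K * t powr \<gamma>'"
    if t: "0 < t" "t \<le> 1" and b: "b \<in> Basis" and z: "z \<in> upper e (a + 1)" for b z t
    unfolding K_def
  proof (rule powr_bound_of_halving[OF \<gamma>'(2) B _ _ _ t, of "(N * C + 4) * M" "\<lambda>t. \<bar>g (z + t *\<^sub>R b) - g z\<bar>"])
    show "0 \<le> (N * C + 4) * M" using N0 C M by simp
    show "\<bar>g (z + t *\<^sub>R b) - g z\<bar> \<le> 2 * (B * M)" if "0 < t" for t
    proof -
      have "z \<in> upper e a" "z + t *\<^sub>R b \<in> upper e a"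
        using z sub upper_add_Basis[OF e b z, of t] that by auto
      from grad[OF \<open>c \<in> Basis\<close> this(1)] grad[OF \<open>c \<in> Basis\<close> this(2)]
      show ?thesis unfolding g_def by linarith
    qed
    show "\<bar>g (z + t *\<^sub>R b) - g z\<bar> \<le> \<bar>g (z + (2 * t) *\<^sub>R b) - g z\<bar> / 2 + (N * C + 4) * M / 2 * t powr \<gamma>'"
      if "0 < t" "t \<le> 1" for t
    proof -
      have "(N * C + 4) * M / 2 * t powr \<gamma>' = (N * C + 4) * M * t powr \<gamma>' / 2" by simp
      moreover have "\<bar>q - p\<bar> \<le> \<bar>r - p\<bar> / 2 + P / 2" if "\<bar>r - 2 * q + p\<bar> \<le> P" for p q r P :: real
        using that abs_ge_self[of "r - p"] abs_ge_minus_self[of "r - p"] unfolding abs_le_iff by auto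
      ultimately show ?thesis using second[OF that b z] by metis
    qed
  qed
  \<comment> \<open>\<open>diff\<close> covers positive steps along one axis. A negative step is the
    positive one with its end points exchanged, and a path along the axes reaches arbitrary
    pairs.\<close>
  have "\<bar>g y - g x\<bar> \<le> DIM('a) * (K * dist x y powr \<gamma>')"
  proof (rule upper_axis_path[where g = g and r = "dist x y", OF e b(2,3)])
    fix z b :: 'a and \<tau> :: real assume z: "z \<in> upper e (a + 1)" "b \<in> Basis" "z + \<tau> *\<^sub>R b \<in> upper e (a + 1)" "\<bar>\<tau>\<bar> \<le> dist x y"
    have K0: "0 \<le> K" using B N0 C M \<gamma>' powr_less_mono[of "\<gamma>' - 1" 0 "2::real"]
      by (auto simp: K_def)
    have le: "K * \<bar>\<tau>\<bar> powr \<gamma>' \<le> K * dist x y powr \<gamma>'"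
      using z(4) \<gamma>' K0 by (intro mult_left_mono powr_mono2) auto
    consider "\<tau> = 0" | "0 < \<tau>" | "\<tau> < 0" by linarith
    then show "\<bar>g (z + \<tau> *\<^sub>R b) - g z\<bar> \<le> K * dist x y powr \<gamma>'"
    proof cases
      case 1
      then show ?thesis using K0 by simp
    next
      case 2
      then show ?thesis using diff[of \<tau> b z] z le \<open>dist x y \<le> 1\<close> by simp
    next
      case 3
      then show ?thesis using diff[of "- \<tau>" b "z + \<tau> *\<^sub>R b"] z le \<open>dist x y \<le> 1\<close>
        by (simp add: abs_minus_commute)
    qed
  qed simp
  also have "DIM('a) * (K * dist x y powr \<gamma>') =
      (N * (4 * B + (N * C + 4) / (1 - 2 powr (\<gamma>' - 1)))) * M * dist x y powr \<gamma>'"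
    by (simp add: K_def N_def algebra_simps add_divide_distrib)
  finally show ?thesis by (simp add: g_def abs_minus_commute)
qed simp

text \<open>\<open>C\<close> and \<open>R\<close> depend only on \<open>n\<close> and the dimension,
  and \<open>M\<close> enters linearly, so the estimate applies to the difference quotients of all
  steps at once. \<open>R\<close> is the distance given up to the boundary.\<close>

lemma holder_gradient:
  "\<exists>C R. 0 \<le> C \<and> 0 \<le> R \<and> (\<forall>e\<in>Basis. \<forall>a v l M. has_lap (upper e a) v l \<longrightarrow> 0 < M \<longrightarrow>
     (\<forall>x\<in>upper e a. \<bar>v x\<bar> \<le> M \<and> \<bar>l x\<bar> \<le> M) \<longrightarrow>
     (\<forall>c\<in>Basis. \<forall>x\<in>upper e (a + R). \<forall>y\<in>upper e (a + R). dist x y \<le> 1 \<longrightarrow>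
        \<bar>partial c v x - partial c v (y::'a::euclidean_space)\<bar> \<le> C * M * dist x y powr (1 - (1 / 2) ^ n)))"
proof (induction n)
  case 0
  define N where "N = real DIM('a)"
  \<comment> \<open>The exponent is 0, so twice the gradient bound at distance 1 is enough. Since 0
    powr 0 is 0, the case x = y is treated apart.\<close>
  have "\<bar>partial c v x - partial c v y\<bar> \<le> (2 * (N + 1)) * M * dist x y powr (1 - (1 / 2) ^ 0)"
    if "e \<in> Basis" "has_lap (upper e a) v l" "0 < M" "\<forall>x\<in>upper e a. \<bar>v x\<bar> \<le> M \<and> \<bar>l x\<bar> \<le> M"
      "c \<in> Basis" "x \<in> upper e (a + 1)" "y \<in> upper e (a + 1)"
    for e c x y :: 'a and a M v l
  proof (cases "x = y")
    case False
    have "\<bar>partial c v z\<bar> \<le> DIM('a) * M / 1 + 1 * M" if "z \<in> upper e (a + 1)" for z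
      by (rule gradient_bound_upper[of e a v l]) (use that \<open>e \<in> Basis\<close> \<open>has_lap (upper e a) v l\<close> \<open>0 < M\<close> \<open>c \<in> Basis\<close>
        \<open>\<forall>x\<in>upper e a. \<bar>v x\<bar> \<le> M \<and> \<bar>l x\<bar> \<le> M\<close> in auto)
    from this[OF that(6)] this[OF that(7)] show ?thesis
      using False unfolding N_def by (simp add: algebra_simps)
  qed simp
  then show ?case
    by (intro exI[of _ "2 * (N + 1)"] exI[of _ 1]) (auto simp: N_def)
next
  case (Suc n)
  from Suc.IH show ?case
  proof (elim exE conjE, goal_cases)
  case (1 C R)
  note CR = 1(1,2) and IH = 1(3)[rule_format]
  define N where "N = real DIM('a)"
  define \<gamma> where "\<gamma> = 1 - (1 / 2 :: real) ^ n"
  define \<gamma>' where "\<gamma>' = (1 + \<gamma>) / 2"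
  define C' where "C' = N * (4 * (N + 1) + (N * C + 4) / (1 - 2 powr (\<gamma>' - 1)))"
  have \<gamma>: "0 \<le> \<gamma>" "\<gamma> < 1" by (simp_all add: \<gamma>_def power_le_one)
  have \<gamma>': "\<gamma>' = 1 - (1 / 2) ^ Suc n" by (simp add: \<gamma>'_def \<gamma>_def field_simps)
  have "2 powr (\<gamma>' - 1) < (1::real)"
    using \<gamma> powr_less_mono[of "\<gamma>' - 1" 0 "2::real"] by (simp add: \<gamma>'_def)
  then have "0 \<le> C'" using CR by (simp add: C'_def N_def)
  have "\<bar>partial c v x - partial c v y\<bar> \<le> C' * M * dist x y powr \<gamma>'"
    if e: "e \<in> Basis" and v: "has_lap (upper e a) v l" and M: "0 < M"
      and bd: "\<forall>x\<in>upper e a. \<bar>v x\<bar> \<le> M \<and> \<bar>l x\<bar> \<le> M"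
      and c: "c \<in> Basis" and xy: "x \<in> upper e (a + (R + 2))" "y \<in> upper e (a + (R + 2))" "dist x y \<le> 1"
    for e c x y :: 'a and a M v l
    unfolding C'_def N_def \<gamma>'_def
  proof (rule holder_gradient_step[OF \<gamma> CR(1) M _ e])
    \<comment> \<open>The step lemma is applied on \<open>upper e (a + R + 1)\<close>: the induction
      hypothesis needs R, the gradient bound needs distance 1 even when R = 0, and the step itself
      gives up another 1. Hence R + 2.\<close>
    have sub: "upper e (a + R + 1) \<subseteq> upper e a" "upper e (a + R + 1) \<subseteq> upper e (a + R)"
      "upper e (a + R + 1) \<subseteq> upper e (a + 1)"
      using CR(2) by (auto intro!: upper_mono)
    show "has_lap (upper e (a + R + 1)) v l" by (rule has_lap_subset[OF v sub(1)])
    show "\<bar>v x\<bar> \<le> M" "\<bar>l x\<bar> \<le> M" if "x \<in> upper e (a + R + 1)" for x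
      using bd sub(1) that by auto
    show "\<bar>partial b v x\<bar> \<le> (real DIM('a) + 1) * M" if "b \<in> Basis" "x \<in> upper e (a + R + 1)" for b x
    proof -
      have "\<bar>partial b v x\<bar> \<le> DIM('a) * M / 1 + 1 * M"
        by (rule gradient_bound_upper[OF v e that(1) _ M]) (use bd sub(3) that in auto)
      then show ?thesis by (simp add: algebra_simps)
    qed
    show "\<bar>partial b v x - partial b v y\<bar> \<le> C * M * dist x y powr \<gamma>"
      if "b \<in> Basis" "x \<in> upper e (a + R + 1)" "y \<in> upper e (a + R + 1)" "dist x y \<le> 1" for b x y
      unfolding \<gamma>_def
      by (rule IH[OF e v M _ that(1) subsetD[OF sub(2) that(2)] subsetD[OF sub(2) that(3)] that(4)])
        (use bd in blast)
    show "x \<in> upper e (a + R + 1 + 1)" "y \<in> upper e (a + R + 1 + 1)"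
      using xy by (simp_all add: upper_def)
    show "c \<in> Basis" "dist x y \<le> 1" by (fact c xy)+
  qed
  then show ?case using \<open>0 \<le> C'\<close> CR unfolding \<gamma>'[symmetric]
    by (intro exI[of _ C'] exI[of _ "R + 2"]) auto
  qed
qed

section \<open>Estimates for the second derivatives of the solution\<close>

lemma C2_on_DERIV2:
  assumes "C2_on S u" "x \<in> S" "b \<in> Basis" "c \<in> Basis"
  shows "((\<lambda>t. partial c u (x + t *\<^sub>R b)) has_real_derivative partial b (partial c u) x) (at 0)"
proof -
  have "has_partial b (partial c u) x" using assms by (auto simp: C2_on_def)
  then show ?thesis
    unfolding has_partial_def partial_def[of b] by (simp add: DERIV_deriv_iff_real_differentiable)
qed

lemma partial_difference_quotient:
  assumes v: "has_lap S v l" and c: "c \<in> Basis" and S: "x \<in> S" "x + p \<in> S"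
  shows "partial c (\<lambda>z. k * (v (z + p) - v z)) x = k * (partial c v (x + p) - partial c v x)"
proof -
  have "((\<lambda>t. v ((x + p) + t *\<^sub>R c)) has_real_derivative partial c v (x + p)) (at 0)"
    by (rule has_lap_partial[OF v S(2) c])
  then have "((\<lambda>t. v (x + t *\<^sub>R c + p)) has_real_derivative partial c v (x + p)) (at 0)"
    by (simp add: add_ac)
  then have "((\<lambda>t. k * (v (x + t *\<^sub>R c + p) - v (x + t *\<^sub>R c))) has_real_derivative
      k * (partial c v (x + p) - partial c v x)) (at 0)"
    by (intro DERIV_diff DERIV_cmult S has_lap_partial[OF v _ c])
  then show ?thesis unfolding partial_def[of c "\<lambda>z. k * (v (z + p) - v z)"]
    by (rule DERIV_imp_deriv)
qed

text \<open>No differentiability is assumed: both functions admit the same derivatives, so the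
  choice made by \<open>deriv\<close> agrees even where none exists.\<close>

lemma partial_diff_const: "partial b (\<lambda>x. u x - z) = partial b u"
proof
  fix x
  have "((\<lambda>t. u (x + t *\<^sub>R b) - z) has_real_derivative D) (at 0) \<longleftrightarrow>
      ((\<lambda>t. u (x + t *\<^sub>R b)) has_real_derivative D) (at 0)" for D
    using DERIV_diff[of "\<lambda>t. u (x + t *\<^sub>R b)" D 0 UNIV "\<lambda>_. z" 0]
      DERIV_add[of "\<lambda>t. u (x + t *\<^sub>R b) - z" D 0 UNIV "\<lambda>_. z" 0] by auto
  then show "partial b (\<lambda>x. u x - z) x = partial b u x"
    unfolding partial_def deriv_def by simp
qed

text \<open>The gradient estimates are applied to the difference quotients of \<open>u\<close>, whose Laplacian is bounded
  because \<open>f\<close> is Lipschitz.\<close>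

lemma derivative_estimates:
  fixes u :: "'a::euclidean_space \<Rightarrow> real" and f :: "real \<Rightarrow> real" and L z :: real
  assumes u: "C2_on (upper e a0) u" and e: "e \<in> Basis" and L: "0 < L" "L-lipschitz_on J f"
    and J: "\<And>x. x \<in> upper e a0 \<Longrightarrow> u x \<in> J" "z \<in> J" and z: "f z = 0"
    and eq: "\<And>x. x \<in> upper e a0 \<Longrightarrow> laplacian u x = - f (u x)"
  shows "\<exists>K R. 0 < K \<and> 0 \<le> R \<and> (\<forall>a\<ge>a0. \<forall>M>0. (\<forall>x\<in>upper e a. \<bar>u x - z\<bar> \<le> M) \<longrightarrow>
    (\<forall>b\<in>Basis. \<forall>c\<in>Basis. \<forall>x\<in>upper e (a + R). \<bar>partial b u x\<bar> \<le> K * M \<and>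
      \<bar>partial b (partial c u) x\<bar> \<le> K * M \<and>
      (\<forall>y\<in>upper e (a + R). dist x y \<le> 1 \<longrightarrow>
        \<bar>partial b (partial c u) x - partial b (partial c u) y\<bar> \<le> K * M * dist x y powr (1 - (1 / 2) ^ n))))"
proof -
  define N where "N = real DIM('a)"
  have N0: "0 \<le> N" by (simp add: N_def)
  have lap: "has_lap (upper e a0) u (\<lambda>x. - f (u x))"
    by (rule has_lap_cong[OF C2_on_has_lap[OF u]]) (rule eq)
  have lip: "\<bar>f s - f t\<bar> \<le> L * \<bar>s - t\<bar>" if "s \<in> J" "t \<in> J" for s t
    using lipschitz_onD[OF L(2) that] by (simp add: dist_real_def)
  from holder_gradient[of n, where 'a='a] show ?thesis
  proof (elim exE conjE, goal_cases)
    case (1 C R)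
    note C = 1(1) and R = 1(2) and holder = 1(3)[rule_format]
    \<comment> \<open>The product dominates N + L, (N + L)^2 and C (1 + L) (N + L), the constants
      for the gradient, the second derivatives and their Hoelder quotients.\<close>
    define K where "K = (N + L) * (1 + N + L + C * (1 + L))"
    have K: "N + L \<le> K" "(N + L) * (N + L) \<le> K" "C * ((1 + L) * (N + L)) \<le> K" "0 < K"
      using N0 L(1) C mult_nonneg_nonneg[of C L] unfolding K_def by (auto simp: algebra_simps intro!: add_nonneg_nonneg add_pos_nonneg)
    have main: "\<bar>partial b u x\<bar> \<le> K * M \<and> \<bar>partial b (partial c u) x\<bar> \<le> K * M \<and>
        (dist x y \<le> 1 \<longrightarrow>
        \<bar>partial b (partial c u) x - partial b (partial c u) y\<bar> \<le> K * M * dist x y powr (1 - (1 / 2) ^ n))"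
      if a: "a0 \<le> a" and M: "0 < M" and bd: "\<And>x. x \<in> upper e a \<Longrightarrow> \<bar>u x - z\<bar> \<le> M"
        and b: "b \<in> Basis" and c: "c \<in> Basis"
        and xy: "x \<in> upper e (a + (R + 2))" "y \<in> upper e (a + (R + 2))" for a M b c x y
    proof -
      define M1 where "M1 = (N + L) * M"
      have M1: "0 < M1" using N0 L M by (simp add: M1_def)
      have sub: "upper e (a + 1) \<subseteq> upper e a" "upper e a \<subseteq> upper e a0"
        "upper e (a + (R + 2)) \<subseteq> upper e (a + 1 + 1)" "upper e (a + (R + 2)) \<subseteq> upper e (a + 1 + R)"
        using a R by (auto intro!: upper_mono)
      have lap': "has_lap (upper e (a + 1)) u (\<lambda>x. - f (u x))"
        by (rule has_lap_subset[OF lap]) (use sub in blast)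
      have grad: "\<bar>partial b u x\<bar> \<le> M1" if "b \<in> Basis" "x \<in> upper e (a + 1)" for b x
      proof -
        \<comment> \<open>Here f z = 0 makes the estimate linear in M: |f (u x)| = |f (u x) - f z|
          \<le> L M.\<close>
        have "\<bar>partial b (\<lambda>x. u x - z) x\<bar> \<le> DIM('a) * M / 1 + 1 * (L * M)"
        proof (rule gradient_bound_upper[OF _ e that(1) _ _ bd _ that(2)])
          show "has_lap (upper e a) (\<lambda>x. u x - z) (\<lambda>x. - f (u x) - 0)"
            by (intro has_lap_diff has_lap_const has_lap_subset[OF lap sub(2)])
          show "\<bar>- f (u x) - 0\<bar> \<le> L * M" if "x \<in> upper e a" for x
          proof -
            have "\<bar>f (u x) - f z\<bar> \<le> L * \<bar>u x - z\<bar>" using lip J sub(2) that by blast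
            also have "\<dots> \<le> L * M" using bd[OF that] L by simp
            finally show ?thesis using z by simp
          qed
        qed (use L M in auto)
        then show ?thesis by (simp add: partial_diff_const M1_def N_def algebra_simps)
      qed
      \<comment> \<open>The second derivative is the limit of \<open>partial c (q h)\<close>, so
        bounds on \<open>q h\<close> and its Laplacian \<open>k h\<close> that are uniform in h
        suffice. Taking h > 0 keeps \<open>w + h *\<^sub>R b\<close> in the half-space.\<close>
      define q where "q h w = (1 / h) * (u (w + h *\<^sub>R b) - u w)" for h w
      define k where "k h w = (1 / h) * (- f (u (w + h *\<^sub>R b)) - - f (u w))" for h w
      have up: "w + h *\<^sub>R b \<in> upper e (a + 1)" if "w \<in> upper e (a + 1)" "0 < h" for w h
        using upper_add_Basis[OF e b that(1), of h] that(2) by simp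
      have q_lap: "has_lap (upper e (a + 1)) (q h) (k h)" if "0 < h" for h
        unfolding q_def k_def
        by (intro has_lap_cmult has_lap_diff lap' has_lap_shift[OF lap'] up that)
      have q: "\<bar>q h w\<bar> \<le> M1" if h: "0 < h" and w: "w \<in> upper e (a + 1)" for h w
      proof -
        have "\<exists>t. 0 < t \<and> t < h \<and> u (w + h *\<^sub>R b) - u (w + 0 *\<^sub>R b) = (h - 0) * partial b u (w + t *\<^sub>R b)"
          by (intro MVT2 h has_lap_partial_at[OF lap'] upper_add_Basis e b w) auto
        then obtain t where t: "0 < t" "u (w + h *\<^sub>R b) - u w = h * partial b u (w + t *\<^sub>R b)" by auto
        then have "q h w = partial b u (w + t *\<^sub>R b)" using h by (simp add: q_def)
        then show ?thesis using grad[OF b up[OF w t(1)]] by simp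
      qed
      have k: "\<bar>k h w\<bar> \<le> L * M1" if h: "0 < h" and w: "w \<in> upper e (a + 1)" for h w
      proof -
        have "\<bar>f (u (w + h *\<^sub>R b)) - f (u w)\<bar> \<le> L * \<bar>u (w + h *\<^sub>R b) - u w\<bar>"
          using lip J up[OF w h] w sub by blast
        moreover have "\<bar>k h w\<bar> = (1 / h) * \<bar>f (u (w + h *\<^sub>R b)) - f (u w)\<bar>"
          using h by (simp add: k_def abs_mult abs_minus_commute)
        moreover have "\<bar>q h w\<bar> = (1 / h) * \<bar>u (w + h *\<^sub>R b) - u w\<bar>"
          using h by (simp add: q_def abs_mult)
        ultimately have "\<bar>k h w\<bar> \<le> L * \<bar>q h w\<bar>" using h by (simp add: divide_right_mono)
        also have "\<dots> \<le> L * M1" using q[OF h w] L by simp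
        finally show ?thesis .
      qed
      have x2: "x \<in> upper e (a + 1 + 1)" "x \<in> upper e (a + 1 + R)" "y \<in> upper e (a + 1 + R)"
        using xy sub by auto
      have mem: "x \<in> upper e (a + 1)" "y \<in> upper e (a + 1)"
        using x2 upper_mono[of "a + 1" "a + 1 + R" e] R by auto
      have lim: "((\<lambda>h. partial c (q h) w) \<longlongrightarrow> partial b (partial c u) w) (at_right 0)"
        if w: "w \<in> upper e (a + 1)" for w
      proof -
        have "((\<lambda>t. partial c u (w + t *\<^sub>R b)) has_real_derivative partial b (partial c u) w) (at 0)"
          by (rule C2_on_DERIV2[OF u _ b c]) (use w sub in blast)
        then have "((\<lambda>h. (partial c u (w + h *\<^sub>R b) - partial c u w) / h) \<longlongrightarrow> partial b (partial c u) w) (at_right 0)"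
          unfolding DERIV_def by (auto intro: tendsto_mono[OF at_le])
        moreover have "\<forall>\<^sub>F h in at_right 0. (partial c u (w + h *\<^sub>R b) - partial c u w) / h = partial c (q h) w"
        proof (rule eventually_at_rightI[of 0 1])
          fix h :: real assume "h \<in> {0<..<1}"
          then show "(partial c u (w + h *\<^sub>R b) - partial c u w) / h = partial c (q h) w"
            unfolding q_def by (subst partial_difference_quotient[OF lap' c w up[OF w]]) auto
        qed simp
        ultimately show ?thesis by (rule Lim_transform_eventually)
      qed
      have "\<bar>partial b u x\<bar> \<le> K * M"
      proof -
        have "M1 \<le> K * M" unfolding M1_def using K(1) M by (intro mult_right_mono) auto
        then show ?thesis using grad[OF b mem(1)] by linarith
      qed
      moreover have "\<bar>partial b (partial c u) x\<bar> \<le> K * M"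
      proof (rule tendsto_upperbound[OF tendsto_rabs[OF lim[OF mem(1)]]])
        show "\<forall>\<^sub>F h in at_right 0. \<bar>partial c (q h) x\<bar> \<le> K * M"
        proof (rule eventually_at_rightI[of 0 1])
          fix h :: real assume "h \<in> {0<..<1}"
          then have h: "0 < h" by simp
          have "\<bar>partial c (q h) x\<bar> \<le> DIM('a) * M1 / 1 + 1 * (L * M1)"
            by (rule gradient_bound_upper[OF q_lap[OF h] e c _ _ q[OF h] k[OF h] x2(1)]) (use L M1 in auto)
          also have "\<dots> = ((N + L) * (N + L)) * M" by (simp add: M1_def N_def algebra_simps)
          also have "\<dots> \<le> K * M" using K(2) M by (intro mult_right_mono) auto
          finally show "\<bar>partial c (q h) x\<bar> \<le> K * M" .
        qed simp
      qed simp
      moreover have "\<bar>partial b (partial c u) x - partial b (partial c u) y\<bar> \<le> K * M * dist x y powr (1 - (1 / 2) ^ n)"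
        if "dist x y \<le> 1"
      proof (rule tendsto_upperbound[OF tendsto_rabs[OF tendsto_diff[OF lim[OF mem(1)] lim[OF mem(2)]]]])
        show "\<forall>\<^sub>F h in at_right 0. \<bar>partial c (q h) x - partial c (q h) y\<bar> \<le> K * M * dist x y powr (1 - (1 / 2) ^ n)"
        proof (rule eventually_at_rightI[of 0 1])
          fix h :: real assume "h \<in> {0<..<1}"
          then have h: "0 < h" by simp
          have "\<bar>partial c (q h) x - partial c (q h) y\<bar> \<le> C * ((1 + L) * M1) * dist x y powr (1 - (1 / 2) ^ n)"
          proof (rule holder[OF e q_lap[OF h] _ _ c x2(2,3) that])
            show "0 < (1 + L) * M1" using L M1 by simp
            have "0 < L * M1" using L M1 by simp
            then show "\<bar>q h w\<bar> \<le> (1 + L) * M1 \<and> \<bar>k h w\<bar> \<le> (1 + L) * M1" if "w \<in> upper e (a + 1)" for w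
              using q[OF h that] k[OF h that] M1 by (simp add: algebra_simps)
          qed
          also have "C * ((1 + L) * M1) = (C * ((1 + L) * (N + L))) * M" by (simp add: M1_def)
          also have "\<dots> * dist x y powr (1 - (1 / 2) ^ n) \<le> K * M * dist x y powr (1 - (1 / 2) ^ n)"
            using K(3) M by (intro mult_right_mono) auto
          finally show "\<bar>partial c (q h) x - partial c (q h) y\<bar> \<le> K * M * dist x y powr (1 - (1 / 2) ^ n)" .
        qed simp
      qed simp
      ultimately show ?thesis by blast
    qed
    show ?case
    proof (rule exI[of _ K], rule exI[of _ "R + 2"], intro conjI allI impI ballI)
      show "0 \<le> R + 2" using R by simp
    qed (use K main in \<open>simp_all\<close>)
  qed
qed

section \<open>Convergence far from the boundary\<close>

lemma cball_subset_upper: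
  assumes "e \<in> Basis" "x \<in> upper e (a + r)"
  shows "cball x r \<subseteq> upper e a"
proof
  fix y assume "y \<in> cball x r"
  then have "\<bar>(x - y) \<bullet> e\<bar> \<le> r"
    using Basis_le_norm[OF assms(1), of "x - y"] by (simp add: dist_norm)
  then show "y \<in> upper e a" using assms(2) by (auto simp: upper_def inner_simps)
qed

lemma has_lap_dist_sq:
  fixes p :: "'a::euclidean_space"
  shows "has_lap S (\<lambda>x. (dist p x)\<^sup>2) (\<lambda>x. 2 * DIM('a))"
proof -
  obtain b :: 'a where b: "b \<in> Basis" using nonempty_Basis by blast
  have "has_lap S (\<lambda>x. 1 * ((x - p) \<bullet> (x - p)) + 0 * ((x - p) \<bullet> b) + 0 * ((x - p) \<bullet> b)\<^sup>2) (\<lambda>x. 2 * real DIM('a) * 1 + 2 * 0)"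
    using has_lap_quadratic[OF b, of S 1 p 0 0] by simp
  moreover have "(x - p) \<bullet> (x - p) = (dist p x)\<^sup>2" for x
    by (metis dist_norm dist_commute power2_norm_eq_inner)
  ultimately show ?thesis by simp
qed

lemma has_lap_gaussian_dist:
  fixes p :: "'a::euclidean_space"
  shows "has_lap S (\<lambda>x. exp (- \<alpha> * (dist p x)\<^sup>2))
    (\<lambda>x. (4 * \<alpha>\<^sup>2 * (dist p x)\<^sup>2 - 2 * \<alpha> * DIM('a)) * exp (- \<alpha> * (dist p x)\<^sup>2))"
proof -
  have "(x - p) \<bullet> (x - p) = (dist p x)\<^sup>2" for x
    by (metis dist_norm dist_commute power2_norm_eq_inner)
  with has_lap_gaussian[of S \<alpha> p] show ?thesis by simp
qed

text \<open>If f m > 0, then \<open>u\<close> is superharmonic by a definite amount wherever it is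
  close to \<open>m\<close>. A paraboloid using up half of this amount keeps the sum superharmonic
  there, yet lifts it above m + \<eta> on a large sphere, so the value at the centre cannot be
  smaller.\<close>

lemma zero_of_limit_inf:
  fixes u :: "'a::euclidean_space \<Rightarrow> real"
  assumes u: "has_lap (upper e a0) u (\<lambda>x. - f (u x))" and e: "e \<in> Basis"
    and u0: "\<And>x. x \<in> upper e a0 \<Longrightarrow> 0 \<le> u x"
    and f: "continuous_on {0..} f" "\<And>s. 0 \<le> s \<Longrightarrow> 0 \<le> f s" and m: "0 \<le> m"
    and low: "\<And>\<eta>. 0 < \<eta> \<Longrightarrow> \<exists>a\<ge>a0. \<forall>x\<in>upper e a. m - \<eta> \<le> u x"
    and near: "\<And>\<eta> a. 0 < \<eta> \<Longrightarrow> a0 \<le> a \<Longrightarrow> \<exists>x\<in>upper e a. u x < m + \<eta>"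
  shows "f m = 0"
proof (rule ccontr)
  assume "f m \<noteq> 0"
  then have fm: "0 < f m" using f(2)[OF m] by simp
  define N where "N = real DIM('a)"
  have N: "0 < N" by (simp add: N_def)
  define \<epsilon> where "\<epsilon> = f m / (4 * N)"
  have \<epsilon>: "0 < \<epsilon>" using fm N by (simp add: \<epsilon>_def)
  obtain \<sigma> where \<sigma>: "0 < \<sigma>" "\<And>s. 0 \<le> s \<Longrightarrow> dist s m < \<sigma> \<Longrightarrow> dist (f s) (f m) < f m / 2"
    using f(1) m fm unfolding continuous_on_iff by (metis atLeast_iff half_gt_zero)
  have fs: "f m / 2 < f s" if "0 \<le> s" "\<bar>s - m\<bar> < \<sigma>" for s
    using \<sigma>(2)[of s] that abs_ge_minus_self[of "f s - f m"] unfolding dist_real_def by linarith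
  define \<eta> where "\<eta> = \<sigma> / 2"
  have \<eta>: "0 < \<eta>" "\<eta> < \<sigma>" using \<sigma>(1) by (simp_all add: \<eta>_def)
  obtain a where a: "a0 \<le> a" "\<And>x. x \<in> upper e a \<Longrightarrow> m - \<eta> \<le> u x" using low[OF \<eta>(1)] by blast
  \<comment> \<open>R \<ge> 1 and \<epsilon> R \<ge> 2 \<eta> together give \<epsilon> R^2 \<ge> 2
    \<eta>, which raises m - \<eta> to m + \<eta> on the sphere.\<close>
  define R where "R = 2 * \<eta> / \<epsilon> + 1"
  have R: "1 \<le> R" using \<eta> \<epsilon> by (simp add: R_def)
  have "R \<le> R\<^sup>2" using R by (simp add: power2_eq_square)
  moreover have "\<epsilon> * R = 2 * \<eta> + \<epsilon>" using \<epsilon> by (simp add: R_def algebra_simps)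
  ultimately have eR: "2 * \<eta> \<le> \<epsilon> * R\<^sup>2" using mult_left_mono[of R "R\<^sup>2" \<epsilon>] \<epsilon> by linarith
  obtain x0 where x0: "x0 \<in> upper e (a + R)" "u x0 < m + \<eta>" using near[OF \<eta>(1), of "a + R"] a(1) R by auto
  have sub: "cball x0 R \<subseteq> upper e a" "upper e a \<subseteq> upper e a0"
    using cball_subset_upper[OF e x0(1)] upper_mono[OF a(1)] by auto
  have lap: "has_lap (cball x0 R) (\<lambda>x. u x + \<epsilon> * (dist x0 x)\<^sup>2) (\<lambda>x. - f (u x) + \<epsilon> * (2 * DIM('a)))"
    by (intro has_lap_add has_lap_cmult has_lap_dist_sq has_lap_subset[OF u]) (use sub in blast)
  have "m + \<eta> \<le> u x0 + \<epsilon> * (dist x0 x0)\<^sup>2"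
  proof (rule has_lap_min_on_compact[OF has_lap_subset[OF lap ball_subset_cball] open_ball ball_subset_cball compact_cball
        has_lap_continuous_on[OF lap]])
    show "- f (u x) + \<epsilon> * (2 * DIM('a)) < 0"
      if x: "x \<in> ball x0 R" "u x + \<epsilon> * (dist x0 x)\<^sup>2 < m + \<eta>" for x
    proof -
      have "0 \<le> \<epsilon> * (dist x0 x)\<^sup>2" using \<epsilon> by simp
      then have "u x < m + \<eta>" using x(2) by linarith
      moreover have "x \<in> upper e a" using x(1) sub(1) by auto
      ultimately have "\<bar>u x - m\<bar> < \<sigma>" "0 \<le> u x" using a(2)[of x] \<eta> u0[of x] sub(2) by auto
      then have "f m / 2 < f (u x)" by (intro fs)
      moreover have "\<epsilon> * (2 * DIM('a)) = f m / 2" using N by (simp add: \<epsilon>_def N_def)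
      ultimately show ?thesis by linarith
    qed
    show "m + \<eta> \<le> u x + \<epsilon> * (dist x0 x)\<^sup>2" if "x \<in> cball x0 R - ball x0 R" for x
    proof -
      have "dist x0 x = R" using that by auto
      moreover have "m - \<eta> \<le> u x" using that sub(1) a(2) by auto
      ultimately show ?thesis using eR by simp
    qed
  qed (use R in simp)
  then show False using x0(2) by simp
qed

section \<open>Gaussian barriers and sliding bumps\<close>

text \<open>The comparison takes place in the annulus between the radii \<open>r\<close> and
  \<open>R\<close>, where the condition on \<alpha> makes the Gaussian strictly subharmonic. In the
  inner ball the gap \<kappa> is enough because exp is at most 1 there; on the outer sphere the
  barrier equals \<open>p\<close>.\<close>

lemma superharmonic_gaussian_bound:
  fixes v :: "'a::euclidean_space \<Rightarrow> real"
  assumes v: "has_lap S v l" and l: "\<And>x. x \<in> S \<Longrightarrow> l x \<le> 0" and S: "cball x0 R \<subseteq> S"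
    and \<kappa>: "0 < \<kappa>" and \<alpha>: "0 < \<alpha>" "real DIM('a) \<le> \<alpha> * r\<^sup>2" and r: "0 \<le> r"
    and p: "\<And>x. x \<in> cball x0 R \<Longrightarrow> p \<le> v x"
    and inner: "\<And>x. x \<in> cball x0 R \<Longrightarrow> dist x0 x \<le> r \<Longrightarrow> p + \<kappa> \<le> v x"
    and x: "x \<in> cball x0 R"
  shows "p + \<kappa> * (exp (- \<alpha> * (dist x0 x)\<^sup>2) - exp (- \<alpha> * R\<^sup>2)) \<le> v x"
proof -
  have lap: "has_lap (cball x0 R) (\<lambda>x. v x - \<kappa> * exp (- \<alpha> * (dist x0 x)\<^sup>2)) (\<lambda>x. l x -
      \<kappa> * ((4 * \<alpha>\<^sup>2 * (dist x0 x)\<^sup>2 - 2 * \<alpha> * DIM('a)) * exp (- \<alpha> * (dist x0 x)\<^sup>2)))"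
    by (intro has_lap_diff has_lap_cmult has_lap_gaussian_dist has_lap_subset[OF v S])
  have "p - \<kappa> * exp (- \<alpha> * R\<^sup>2) \<le> v x - \<kappa> * exp (- \<alpha> * (dist x0 x)\<^sup>2)"
  proof (rule has_lap_min_on_compact[OF has_lap_subset[OF lap] _ _ compact_cball has_lap_continuous_on[OF lap] _ _ x,
        of "ball x0 R - cball x0 r"])
    show "l x - \<kappa> * ((4 * \<alpha>\<^sup>2 * (dist x0 x)\<^sup>2 - 2 * \<alpha> * DIM('a)) * exp (- \<alpha> * (dist x0 x)\<^sup>2)) < 0"
      if x: "x \<in> ball x0 R - cball x0 r" for x
    proof -
      have "r\<^sup>2 \<le> (dist x0 x)\<^sup>2" using x r by (intro power_mono) auto
      then have "\<alpha> * r\<^sup>2 \<le> \<alpha> * (dist x0 x)\<^sup>2" using \<alpha> by simp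
      then have "DIM('a) \<le> \<alpha> * (dist x0 x)\<^sup>2" using \<alpha>(2) by linarith
      moreover have "0 < real DIM('a)" by simp
      ultimately have "0 < 2 * \<alpha> * (2 * (\<alpha> * (dist x0 x)\<^sup>2) - DIM('a))"
        using \<alpha>(1) by (intro mult_pos_pos) linarith+
      also have "\<dots> = 4 * \<alpha>\<^sup>2 * (dist x0 x)\<^sup>2 - 2 * \<alpha> * DIM('a)"
        by (simp add: algebra_simps power2_eq_square)
      finally have "0 < \<kappa> * ((4 * \<alpha>\<^sup>2 * (dist x0 x)\<^sup>2 - 2 * \<alpha> * DIM('a)) * exp (- \<alpha> * (dist x0 x)\<^sup>2))"
        using \<kappa> by simp
      moreover have "l x \<le> 0" using x S by (intro l) auto
      ultimately show ?thesis by linarith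
    qed
    show "p - \<kappa> * exp (- \<alpha> * R\<^sup>2) \<le> v x - \<kappa> * exp (- \<alpha> * (dist x0 x)\<^sup>2)"
      if x: "x \<in> cball x0 R - (ball x0 R - cball x0 r)" for x
    proof (cases "dist x0 x \<le> r")
      case True
      have "\<kappa> * exp (- \<alpha> * (dist x0 x)\<^sup>2) \<le> \<kappa> * 1" using \<kappa> \<alpha> by (intro mult_left_mono) auto
      moreover have "0 \<le> \<kappa> * exp (- \<alpha> * R\<^sup>2)" using \<kappa> by simp
      moreover have "p + \<kappa> \<le> v x" using inner[of x] x True by blast
      ultimately show ?thesis by linarith
    next
      case False
      then have "dist x0 x = R" using x by auto
      then show ?thesis using p[of x] x by auto
    qed
  qed (auto simp: open_Diff)
  then show ?thesis by (simp add: algebra_simps)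
qed

lemma exp_neg_half_le: "exp (- (1 / 2)) \<le> (2 / 3 :: real)"
proof -
  have "3 / 2 \<le> exp (1 / 2 :: real)" using exp_ge_add_one_self[of "1 / 2 :: real"] by simp
  then have "inverse (exp (1 / 2)) \<le> inverse (3 / 2 :: real)" by (intro le_imp_inverse_le) auto
  then show ?thesis by (simp add: exp_minus)
qed

text \<open>Up to the factor \<epsilon> this is the lower bound for \<open>f\<close> plus the
  Laplacian of the bump, with s = \<alpha> |x - y|^2. For s \<ge> N/2 the Laplacian is nonnegative.
  For s < N/2 one has N - s > 1/2, so 1 - exp (s - N) \<ge> 1/3, and 8/3 > 2 beats the negative
  part. This is the origin of the constant 8.\<close>

lemma gaussian_profile_pos:
  fixes N \<alpha> s :: real
  assumes N: "1 \<le> N" and \<alpha>: "0 < \<alpha>" and s0: "0 \<le> s" and s: "s < N"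
  shows "0 < 8 * N * \<alpha> * (exp (- s) - exp (- N)) + (4 * \<alpha> * s - 2 * \<alpha> * N) * exp (- s)"
proof -
  have "0 < 8 * N * (1 - exp (s - N)) + 4 * s - 2 * N"
  proof (cases "N / 2 \<le> s")
    case True
    have "exp (s - N) < 1" using s by simp
    then have "0 < 8 * N * (1 - exp (s - N))" using N by (intro mult_pos_pos) auto
    then show ?thesis using True by linarith
  next
    case False
    then have "exp (s - N) \<le> exp (- (1 / 2))" using N by simp
    then have "1 / 3 \<le> 1 - exp (s - N)" using exp_neg_half_le by linarith
    then have "8 * N * (1 / 3) \<le> 8 * N * (1 - exp (s - N))" using N by (intro mult_left_mono) auto
    moreover have "- 2 * N + 4 * s + 8 * N * (1 / 3) > 0 \<or> s < 0" using N by linarith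
    ultimately show ?thesis using s0 N by linarith
  qed
  then have "0 < \<alpha> * exp (- s) * (8 * N * (1 - exp (s - N)) + 4 * s - 2 * N)"
    using \<alpha> by (intro mult_pos_pos) auto
  also have "\<dots> = 8 * N * \<alpha> * (exp (- s) - exp (- s) * exp (s - N)) + (4 * \<alpha> * s - 2 * \<alpha> * N) * exp (- s)"
    by (simp add: algebra_simps)
  also have "exp (- s) * exp (s - N) = exp (- N)" by (simp flip: exp_add)
  finally show ?thesis .
qed

text \<open>The bump \<open>m + \<epsilon> (exp (- \<alpha> \<bar>x - y\<bar>\<^sup>2) - exp (- N))\<close> is a strict subsolution where it is nonnegative.
  Outside the ball of radius \<open>R\<close> around \<open>y\<close> it stays below \<open>u\<close> by \<open>low\<close>, so it never touches \<open>u\<close> while its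
  centre \<open>y\<close> moves from \<open>y0\<close> to \<open>y1\<close>.\<close>

lemma sliding_bump:
  fixes u :: "'a::euclidean_space \<Rightarrow> real" and f :: "real \<Rightarrow> real"
  defines "N \<equiv> real DIM('a)"
  assumes u: "has_lap (upper e a) u (\<lambda>x. - f (u x))" and e: "e \<in> Basis"
    and u0: "\<And>x. x \<in> upper e a \<Longrightarrow> 0 \<le> u x"
    and f: "\<And>s. 0 \<le> s \<Longrightarrow> 0 \<le> f s" and \<alpha>: "0 < \<alpha>"
    and f_lower: "\<And>s. m \<le> s \<Longrightarrow> s \<le> m + \<sigma> \<Longrightarrow> 8 * N * \<alpha> * (s - m) \<le> f s"
    and \<epsilon>: "0 < \<epsilon>" "\<epsilon> \<le> \<sigma>" and R: "0 \<le> R" "N + 1 \<le> \<alpha> * R\<^sup>2"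
    and low: "\<And>x. x \<in> upper e a \<Longrightarrow> m + \<epsilon> * (exp (- (N + 1)) - exp (- N)) < u x"
    and y0: "y0 \<in> upper e (a + R)" "\<And>x. x \<in> cball y0 R \<Longrightarrow> m + \<epsilon> \<le> u x"
    and y1: "y1 \<in> upper e (a + R)"
  shows "m + \<epsilon> * (1 - exp (- N)) < u y1"
proof -
  define y where "y t = y0 + t *\<^sub>R (y1 - y0)" for t :: real
  define \<psi> where "\<psi> x = m + \<epsilon> * (exp (- \<alpha> * (dist 0 x)\<^sup>2) - exp (- N))" for x :: 'a
  \<comment> \<open>\<open>u\<close> is translated instead of the bump, so that everything happens
    on the fixed compact set of pairs in \<open>{0..1} \<times> cball 0 R\<close>.\<close>
  define G where "G t x = u (y t + x) - \<psi> x" for t x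
  have N1: "1 \<le> N" unfolding N_def using DIM_positive[where 'a='a] by linarith
  have y_up: "y t \<in> upper e (a + R)" if "0 \<le> t" "t \<le> 1" for t
  proof -
    have "(a + R) * (1 - t) + (a + R) * t < (y0 \<bullet> e) * (1 - t) + (y1 \<bullet> e) * t"
    proof (cases "t = 0")
      case False
      then show ?thesis using y0(1) y1 that
        by (intro add_le_less_mono mult_right_mono mult_strict_right_mono) (auto simp: upper_def)
    qed (use y0 in \<open>simp add: upper_def\<close>)
    then show ?thesis by (simp add: upper_def y_def inner_simps algebra_simps)
  qed
  have yx: "y t + x \<in> upper e a" if "0 \<le> t" "t \<le> 1" "x \<in> cball 0 R" for t x
    using cball_subset_upper[OF e y_up[OF that(1,2)]] that(3) by (auto simp: dist_norm)
  have G_cont: "continuous_on ({0..1} \<times> cball 0 R) (\<lambda>z. G (fst z) (snd z))"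
    unfolding G_def \<psi>_def y_def
    by (intro continuous_intros continuous_on_compose2[OF has_lap_continuous_on[OF u]])
      (use yx in \<open>auto simp: y_def\<close>)
  have G0: "0 < G 0 x" if "x \<in> cball 0 R" for x
  proof -
    have "exp (- \<alpha> * (dist 0 x)\<^sup>2) \<le> 1" using \<alpha> by simp
    then have "\<epsilon> * (exp (- \<alpha> * (dist 0 x)\<^sup>2) - exp (- N)) < \<epsilon> * 1"
      using \<epsilon>(1) exp_gt_zero[of "- N"] by (intro mult_strict_left_mono) linarith+
    moreover have "m + \<epsilon> \<le> u (y0 + x)" using that by (intro y0(2)) (simp add: dist_norm)
    ultimately show ?thesis by (simp add: G_def \<psi>_def y_def)
  qed
  define Z where "Z = {z \<in> {0..1} \<times> cball 0 R. G (fst z) (snd z) \<le> 0}"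
  have "Z = {}"
  proof (rule ccontr)
    assume "Z \<noteq> {}"
    have "compact Z"
    proof -
      have "closedin (top_of_set ({0..1} \<times> cball 0 R)) (({0..1} \<times> cball 0 R) \<inter> (\<lambda>z. G (fst z) (snd z)) -` {..0})"
        by (rule continuous_closedin_preimage[OF G_cont closed_atMost])
      moreover have "({0..1} \<times> cball 0 R) \<inter> (\<lambda>z. G (fst z) (snd z)) -` {..0} = Z" by (auto simp: Z_def)
      ultimately show ?thesis
        using closedin_compact[OF compact_Times[OF compact_Icc compact_cball]] by metis
    qed
    \<comment> \<open>The contact with the smallest parameter t. At that parameter G is still
      nonnegative: by \<open>G0\<close> and the intermediate value theorem, a negative value would
      force a strictly earlier contact.\<close>
    then obtain z where z: "z \<in> Z" "\<And>w. w \<in> Z \<Longrightarrow> fst z \<le> fst w"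
      using continuous_attains_inf[OF _ \<open>Z \<noteq> {}\<close> continuous_on_fst[OF continuous_on_id]] by auto
    obtain t x where tx: "z = (t, x)" by (cases z)
    have t: "0 \<le> t" "t \<le> 1" and x: "x \<in> cball 0 R" and Gx: "G t x \<le> 0"
      using z(1) by (auto simp: tx Z_def)
    have ge: "0 \<le> G t w" if w: "w \<in> cball 0 R" for w
    proof (rule ccontr)
      assume neg: "\<not> 0 \<le> G t w"
      have "continuous_on {0..t} (\<lambda>s. G s w)"
        by (rule continuous_on_compose2[OF G_cont, of _ "\<lambda>s. (s, w)", simplified])
          (use w t in \<open>auto intro!: continuous_intros\<close>)
      then obtain s where s: "0 \<le> s" "s \<le> t" "G s w = 0"
        using IVT2'[of "\<lambda>s. G s w" t 0 0] neg G0[OF w] t by auto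
      have "(s, w) \<in> Z" using s t w by (auto simp: Z_def)
      then have "t \<le> s" using z(2) by (auto simp: tx)
      then show False using s neg by auto
    qed
    have G_eq: "G t x = 0" using ge[OF x] Gx by simp
    \<comment> \<open>On the sphere the bump is no higher than the level that \<open>low\<close>
      places strictly below \<open>u\<close>.\<close>
    have "dist 0 x \<noteq> R"
    proof
      assume "dist 0 x = R"
      then have "exp (- \<alpha> * (dist 0 x)\<^sup>2) \<le> exp (- (N + 1))" using R(2) by simp
      then have "\<epsilon> * (exp (- \<alpha> * (dist 0 x)\<^sup>2) - exp (- N)) \<le> \<epsilon> * (exp (- (N + 1)) - exp (- N))"
        using \<epsilon>(1) by (intro mult_left_mono) auto
      then show False using low[OF yx[OF t x]] G_eq by (simp add: G_def \<psi>_def)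
    qed
    then have x_in: "x \<in> ball 0 R" using x by auto
    have lap: "has_lap (ball 0 R) (\<lambda>x. u (x + y t) - (m + \<epsilon> * (exp (- \<alpha> * (dist 0 x)\<^sup>2) - exp (- N))))
       (\<lambda>x. - f (u (x + y t)) - (0 + \<epsilon> * ((4 * \<alpha>\<^sup>2 * (dist 0 x)\<^sup>2 - 2 * \<alpha> * DIM('a)) * exp (- \<alpha> * (dist 0 x)\<^sup>2) - 0)))"
      by (intro has_lap_diff has_lap_add has_lap_cmult has_lap_const has_lap_gaussian_dist has_lap_shift[OF u])
        (use yx[OF t] in \<open>auto simp: add.commute\<close>)
    define s where "s = \<alpha> * (dist 0 x)\<^sup>2"
    have s0: "0 \<le> s" using \<alpha> by (simp add: s_def)
    have "0 \<le> - f (u (x + y t)) - (0 + \<epsilon> * ((4 * \<alpha>\<^sup>2 * (dist 0 x)\<^sup>2 - 2 * \<alpha> * DIM('a)) * exp (- \<alpha> * (dist 0 x)\<^sup>2) - 0))"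
    proof (rule has_lap_local_min[OF lap open_ball x_in])
      fix w :: 'a assume "w \<in> ball 0 R"
      then have "0 \<le> G t w" using ge[of w] by simp
      then show "u (x + y t) - (m + \<epsilon> * (exp (- \<alpha> * (dist 0 x)\<^sup>2) - exp (- N)))
          \<le> u (w + y t) - (m + \<epsilon> * (exp (- \<alpha> * (dist 0 w)\<^sup>2) - exp (- N)))"
        using G_eq by (simp add: G_def \<psi>_def add.commute)
    qed
    then have "f (u (y t + x)) + \<epsilon> * ((4 * \<alpha> * s - 2 * \<alpha> * N) * exp (- s)) \<le> 0"
      by (simp add: s_def N_def add.commute power2_eq_square mult_ac)
    \<comment> \<open>For s < N the contact value lies between m and m + \<sigma>, so
      \<open>f_lower\<close> applies to it. For s \<ge> N it is at most m, but there the Gaussian is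
      strictly subharmonic and f \<ge> 0 is enough.\<close>
    moreover have "0 < f (u (y t + x)) + \<epsilon> * ((4 * \<alpha> * s - 2 * \<alpha> * N) * exp (- s))"
    proof (cases "s < N")
      case True
      have val: "u (y t + x) = m + \<epsilon> * (exp (- s) - exp (- N))"
        using G_eq by (simp add: G_def \<psi>_def s_def)
      have "exp (- s) \<le> 1" using s0 by simp
      then have "\<epsilon> * (exp (- s) - exp (- N)) \<le> \<epsilon> * 1"
        using \<epsilon>(1) exp_gt_zero[of "- N"] by (intro mult_left_mono) linarith+
      moreover have "0 \<le> \<epsilon> * (exp (- s) - exp (- N))" using \<epsilon>(1) True by simp
      ultimately have "8 * N * \<alpha> * (\<epsilon> * (exp (- s) - exp (- N))) \<le> f (u (y t + x))"
        using f_lower[of "u (y t + x)"] \<epsilon>(2) unfolding val by simp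
      moreover have "0 < \<epsilon> * (8 * N * \<alpha> * (exp (- s) - exp (- N)) + (4 * \<alpha> * s - 2 * \<alpha> * N) * exp (- s))"
        using gaussian_profile_pos[OF N1 \<alpha> s0 True] \<epsilon>(1) by simp
      ultimately show ?thesis by (simp add: algebra_simps)
    next
      case False
      have "0 < 2 * \<alpha> * (2 * s - N)" using False N1 \<alpha> by (intro mult_pos_pos) auto
      then have "0 < (4 * \<alpha> * s - 2 * \<alpha> * N) * exp (- s)" by (intro mult_pos_pos) (auto simp: algebra_simps)
      then show ?thesis using f[OF u0[OF yx[OF t x]]] \<epsilon>(1) by (simp add: add_nonneg_pos)
    qed
    ultimately show False by linarith
  qed
  then have "(1, 0) \<notin> Z" by blast
  then have "0 < G 1 0" using R by (simp add: Z_def)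
  then show ?thesis by (simp add: G_def \<psi>_def y_def)
qed

lemma superharmonic_pos:
  fixes v :: "'a::euclidean_space \<Rightarrow> real"
  assumes v: "has_lap (upper e 0) v l" and e: "e \<in> Basis" and l: "\<And>x. x \<in> upper e 0 \<Longrightarrow> l x \<le> 0"
    and v0: "\<And>x. x \<in> upper e 0 \<Longrightarrow> 0 \<le> v x" and x0: "x0 \<in> upper e 0" "0 < v x0"
    and y: "y \<in> upper e 0"
  shows "0 < v y"
proof -
  \<comment> \<open>Positivity spreads from \<open>x\<close> to the largest ball around \<open>x\<close> in the half-space; connectedness
    does the rest.\<close>
  have near: "0 < v y" if x: "x \<in> upper e 0" "0 < v x" and d: "dist x y < x \<bullet> e" for x y
  proof -
    obtain R where R: "dist x y < R" "R < x \<bullet> e" using dense[OF d] by blast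
    have R0: "0 < R" using R(1) zero_le_dist[of x y] by linarith
    have sub: "cball x R \<subseteq> upper e 0" using R(2) by (intro cball_subset_upper[OF e]) (simp add: upper_def)
    have "continuous (at x) v"
      using has_lap_continuous_on[OF v] x(1) continuous_on_eq_continuous_at[OF open_upper] by blast
    then obtain r where r: "0 < r" "\<And>w. dist w x < r \<Longrightarrow> dist (v w) (v x) < v x / 2"
      unfolding continuous_at using x(2) by (metis half_gt_zero tendsto_dist_iff continuous_at continuous_at_eps_delta)
    define \<rho> where "\<rho> = r / 2"
    define \<alpha> where "\<alpha> = DIM('a) / \<rho>\<^sup>2"
    have \<rho>: "0 < \<rho>" "\<rho> < r" using r by (simp_all add: \<rho>_def)
    have \<alpha>: "0 < \<alpha>" "real DIM('a) \<le> \<alpha> * \<rho>\<^sup>2" using \<rho> by (simp_all add: \<alpha>_def)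
    have "0 + v x / 2 * (exp (- \<alpha> * (dist x y)\<^sup>2) - exp (- \<alpha> * R\<^sup>2)) \<le> v y"
    proof (rule superharmonic_gaussian_bound[OF v l sub _ \<alpha>])
      show "0 + v x / 2 \<le> v w" if "dist x w \<le> \<rho>" for w
      proof -
        have "dist (v w) (v x) < v x / 2" using that \<rho> by (intro r(2)) (simp add: dist_commute)
        then show ?thesis using abs_ge_minus_self[of "v w - v x"] by (simp add: dist_real_def)
      qed
    qed (use x R \<rho> sub v0 in auto)
    moreover have "(dist x y)\<^sup>2 < R\<^sup>2" using R(1) by (intro power_strict_mono) auto
    then have "exp (- \<alpha> * R\<^sup>2) < exp (- \<alpha> * (dist x y)\<^sup>2)" using \<alpha>(1) by simp
    then have "0 < v x / 2 * (exp (- \<alpha> * (dist x y)\<^sup>2) - exp (- \<alpha> * R\<^sup>2))" using x(2) by simp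
    ultimately show ?thesis by linarith
  qed
  define U where "U = upper e 0 \<inter> v -` {0<..}"
  \<comment> \<open>The radius is half the height of \<open>w\<close>: a point x of this ball has
    height above half that of \<open>w\<close>, hence above \<open>dist x w\<close>, and positivity
    at x would spread to \<open>w\<close> by \<open>near\<close>. So \<open>U\<close> and
    \<open>V\<close> do not meet in the half-space.\<close>
  define V where "V = (\<Union>w\<in>{w \<in> upper e 0. v w = 0}. ball w (w \<bullet> e / 2))"
  have "connected (upper e (0::real))"
    using convex_connected[OF convex_halfspace_gt[of 0 e]] by (simp add: upper_def inner_commute)
  moreover have "open U" unfolding U_def
    by (rule continuous_open_preimage[OF has_lap_continuous_on[OF v] open_upper]) simp
  moreover have "open V" unfolding V_def by blast
  moreover have "upper e 0 \<subseteq> U \<union> V"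
  proof
    fix w assume w: "w \<in> upper e 0"
    show "w \<in> U \<union> V"
    proof (cases "v w = 0")
      case True
      then have "w \<in> V" unfolding V_def using w by (intro UN_I[of w]) (auto simp: upper_def)
      then show ?thesis by blast
    next
      case False
      then show ?thesis using v0[OF w] w by (auto simp: U_def)
    qed
  qed
  moreover have "U \<inter> V \<inter> upper e 0 = {}"
  proof (rule ccontr)
    assume "U \<inter> V \<inter> upper e 0 \<noteq> {}"
    then obtain x w where x: "x \<in> upper e 0" "0 < v x" and w: "v w = 0" "dist w x < w \<bullet> e / 2"
      by (auto simp: U_def V_def)
    have "\<bar>(w - x) \<bullet> e\<bar> \<le> dist w x" using Basis_le_norm[OF e] by (simp add: dist_norm)
    then have "dist x w < x \<bullet> e" using w(2) by (simp add: inner_simps dist_commute)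
    then show False using near[OF x] w(1) by force
  qed
  ultimately have "U \<inter> upper e 0 = {} \<or> V \<inter> upper e 0 = {}"
    by (intro connectedD)
  moreover have "x0 \<in> U" using x0 by (simp add: U_def)
  ultimately have "V \<inter> upper e 0 = {}" using x0(1) by blast
  then have "y \<in> U" using \<open>upper e 0 \<subseteq> U \<union> V\<close> y by blast
  then show ?thesis by (simp add: U_def)
qed

text \<open>\<alpha> fits the slope \<delta> to the constant in \<open>gaussian_profile_pos\<close>;
  at radius \<open>R\<close> the Gaussian has dropped to exp (-(N + 1)) or less.\<close>

lemma bump_parameters:
  fixes \<delta> :: real and N :: real
  assumes "0 < \<delta>" "1 \<le> N"
  obtains \<alpha> R where "0 < \<alpha>" "\<delta> = 8 * N * \<alpha>" "0 < R" "N + 1 \<le> \<alpha> * R\<^sup>2"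
proof -
  define \<alpha> where "\<alpha> = \<delta> / (8 * N)"
  define R where "R = sqrt ((N + 1) / \<alpha>)"
  have "0 < \<alpha>" "\<delta> = 8 * N * \<alpha>" using assms by (simp_all add: \<alpha>_def)
  moreover have "0 < R" using assms \<open>0 < \<alpha>\<close> by (simp add: R_def)
  moreover have "\<alpha> * R\<^sup>2 = N + 1" using assms \<open>0 < \<alpha>\<close> by (simp add: R_def)
  ultimately show thesis using that[of \<alpha> R] by simp
qed

text \<open>By the strong minimum principle \<open>u\<close> has a positive minimum on a closed
  ball, which makes room for a first bump. The lower bound required by \<open>sliding_bump\<close>
  is just u \<ge> 0, as a bump above 0 is negative near its sphere.\<close>

lemma eventually_bounded_below_pos:
  fixes u :: "'a::euclidean_space \<Rightarrow> real"
  assumes u: "has_lap (upper e 0) u (\<lambda>x. - f (u x))" and e: "e \<in> Basis"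
    and u0: "\<And>x. x \<in> upper e 0 \<Longrightarrow> 0 \<le> u x" and f: "\<And>s. 0 \<le> s \<Longrightarrow> 0 \<le> f s"
    and f_lower: "0 < \<delta>" "0 < \<sigma>" "\<And>s. 0 \<le> s \<Longrightarrow> s \<le> \<sigma> \<Longrightarrow> \<delta> * s \<le> f s"
    and x0: "x0 \<in> upper e 0" "0 < u x0"
  shows "\<exists>c>0. \<exists>a\<ge>0. \<forall>y\<in>upper e a. c < u y"
proof -
  define N where "N = real DIM('a)"
  have N1: "1 \<le> N" unfolding N_def using DIM_positive[where 'a='a] by linarith
  obtain \<alpha> R where \<alpha>: "0 < \<alpha>" "\<delta> = 8 * N * \<alpha>" and R: "0 < R" "N + 1 \<le> \<alpha> * R\<^sup>2"
    using bump_parameters[OF f_lower(1) N1] by blast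
  define y0 where "y0 = (R + 1) *\<^sub>R e"
  have y0: "y0 \<in> upper e (0 + R)" using e by (simp add: upper_def y0_def)
  have sub: "cball y0 R \<subseteq> upper e 0" by (rule cball_subset_upper[OF e y0])
  have pos: "0 < u y" if "y \<in> upper e 0" for y
    by (rule superharmonic_pos[OF u e _ u0 x0 that]) (use f u0 in auto)
  obtain w where w: "w \<in> cball y0 R" "\<And>x. x \<in> cball y0 R \<Longrightarrow> u w \<le> u x"
    using continuous_attains_inf[OF compact_cball _ continuous_on_subset[OF has_lap_continuous_on[OF u] sub]] R
    by (metis centre_in_cball empty_iff less_imp_le)
  define \<epsilon> where "\<epsilon> = min (u w) \<sigma>"
  have \<epsilon>: "0 < \<epsilon>" "\<epsilon> \<le> \<sigma>" using pos w(1) sub f_lower by (auto simp: \<epsilon>_def)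
  have "0 + \<epsilon> * (1 - exp (- N)) < u y" if y: "y \<in> upper e (0 + R)" for y
    unfolding N_def
  proof (rule sliding_bump[OF u e u0 f \<alpha>(1) _ \<epsilon> _ _ _ y0 _ y])
    show "8 * real DIM('a) * \<alpha> * (s - 0) \<le> f s" if "0 \<le> s" "s \<le> 0 + \<sigma>" for s
      using f_lower(3)[of s] that \<alpha>(2) by (simp add: N_def)
    show "0 + \<epsilon> * (exp (- (real DIM('a) + 1)) - exp (- real DIM('a))) < u x" if "x \<in> upper e 0" for x
    proof -
      have "\<epsilon> * (exp (- (real DIM('a) + 1)) - exp (- real DIM('a))) < 0"
        using \<epsilon>(1) by (intro mult_pos_neg) auto
      then show ?thesis using u0[OF that] by linarith
    qed
    show "0 + \<epsilon> \<le> u x" if "x \<in> cball y0 R" for x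
      using w(2)[OF that] by (simp add: \<epsilon>_def)
  qed (use R N_def in auto)
  moreover have "0 < \<epsilon> * (1 - exp (- N))" using \<epsilon>(1) N1 by simp
  ultimately show ?thesis using R(1)
    by (intro exI[of _ "\<epsilon> * (1 - exp (- N))"] exI[of _ R] conjI ballI) auto
qed

text \<open>The order of the choices matters. The Lipschitz constant fixes r, and with it \<theta>
  and \<epsilon>, independently of the point where \<open>u\<close> is large. Then \<eta> is taken
  small against \<epsilon> and determines a, and only then is the point \<open>x0\<close> picked,
  far beyond a.\<close>

lemma limit_inf_is_limit:
  fixes u :: "'a::euclidean_space \<Rightarrow> real"
  assumes u: "has_lap (upper e 0) u (\<lambda>x. - f (u x))" and e: "e \<in> Basis"
    and u0: "\<And>x. x \<in> upper e 0 \<Longrightarrow> 0 \<le> u x" and f: "\<And>s. 0 \<le> s \<Longrightarrow> 0 \<le> f s"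
    and f_lower: "0 < \<delta>" "0 < \<sigma>" "\<And>s. m \<le> s \<Longrightarrow> s \<le> m + \<sigma> \<Longrightarrow> \<delta> * (s - m) \<le> f s"
    and low: "\<And>\<eta>. 0 < \<eta> \<Longrightarrow> \<exists>a\<ge>0. \<forall>x\<in>upper e a. m - \<eta> \<le> u x"
    and near: "\<And>\<eta> a. 0 < \<eta> \<Longrightarrow> 0 \<le> a \<Longrightarrow> \<exists>x\<in>upper e a. u x < m + \<eta>"
    and lip: "0 \<le> a1" "\<And>x y. x \<in> upper e a1 \<Longrightarrow> y \<in> upper e a1 \<Longrightarrow> \<bar>u x - u y\<bar> \<le> C * dist x y"
    and \<kappa>: "0 < \<kappa>"
  shows "\<exists>a\<ge>0. \<forall>x\<in>upper e a. u x \<le> m + \<kappa>"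
proof (rule ccontr)
  assume contr: "\<not> ?thesis"
  define N where "N = real DIM('a)"
  have N1: "1 \<le> N" unfolding N_def using DIM_positive[where 'a='a] by linarith
  obtain \<alpha> R where \<alpha>: "0 < \<alpha>" "\<delta> = 8 * N * \<alpha>" and R: "0 < R" "N + 1 \<le> \<alpha> * R\<^sup>2"
    using bump_parameters[OF f_lower(1) N1] by blast
  define r where "r = \<kappa> / (2 * (\<bar>C\<bar> + 1))"
  have r: "0 < r" "C * r \<le> \<kappa> / 2"
  proof -
    show "0 < r" using \<kappa> by (simp add: r_def)
    have "C * r \<le> (\<bar>C\<bar> + 1) * r" using \<open>0 < r\<close> by (intro mult_right_mono) auto
    also have "\<dots> = \<kappa> / 2" by (simp add: r_def field_simps)
    finally show "C * r \<le> \<kappa> / 2" .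
  qed
  define \<beta> where "\<beta> = N / r\<^sup>2"
  have \<beta>: "0 < \<beta>" "real DIM('a) \<le> \<beta> * r\<^sup>2" using r N1 by (simp_all add: \<beta>_def N_def)
  \<comment> \<open>The gain over m - \<eta> on \<open>cball x0 R\<close> provided by
    \<open>superharmonic_gaussian_bound\<close> on the ball of twice the radius. One half of it pays
    for \<eta>, the other is left for \<epsilon>.\<close>
  define \<theta> where "\<theta> = \<kappa> / 2 * (exp (- \<beta> * R\<^sup>2) - exp (- \<beta> * (2 * R)\<^sup>2))"
  have "R\<^sup>2 < (2 * R)\<^sup>2" using R by (intro power_strict_mono) auto
  then have \<theta>: "0 < \<theta>" using \<kappa> \<beta>(1) by (simp add: \<theta>_def)
  define \<epsilon> where "\<epsilon> = min (\<theta> / 2) \<sigma>"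
  have \<epsilon>: "0 < \<epsilon>" "\<epsilon> \<le> \<sigma>" "\<epsilon> \<le> \<theta> / 2" using \<theta> f_lower(2) by (simp_all add: \<epsilon>_def)
  define \<kappa>0 where "\<kappa>0 = exp (- N) - exp (- (N + 1))"
  have \<kappa>0: "0 < \<kappa>0" by (simp add: \<kappa>0_def)
  \<comment> \<open>Where \<alpha> |x - y|^2 = N + 1 the bump is at m - \<epsilon> \<kappa>0. The
    second bound keeps m - \<eta> strictly above that level, as \<open>low\<close> in
    \<open>sliding_bump\<close> requires.\<close>
  define \<eta> where "\<eta> = min (\<theta> / 2) (\<epsilon> * \<kappa>0 / 2)"
  have "0 < \<epsilon> * \<kappa>0" using \<epsilon> \<kappa>0 by simp
  then have \<eta>: "0 < \<eta>" "\<eta> \<le> \<theta> / 2" "\<eta> < \<epsilon> * \<kappa>0"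
    using \<theta> unfolding \<eta>_def by (auto simp: min_def)
  obtain a' where a': "0 \<le> a'" "\<And>x. x \<in> upper e a' \<Longrightarrow> m - \<eta> \<le> u x" using low[OF \<eta>(1)] by blast
  define a where "a = max a' a1"
  have sub: "upper e a \<subseteq> upper e a'" "upper e a \<subseteq> upper e a1" "upper e a \<subseteq> upper e 0" "0 \<le> a"
    using a'(1) by (auto intro!: upper_mono simp: a_def)
  have ge: "m - \<eta> \<le> u x" if "x \<in> upper e a" for x using a'(2) sub that by blast
  have ua: "has_lap (upper e a) u (\<lambda>x. - f (u x))" by (rule has_lap_subset[OF u sub(3)])
  obtain x0 where x0: "x0 \<in> upper e (a + 2 * R)" "m + \<kappa> < u x0"
    using contr sub(4) R(1) by (auto simp: not_le dest!: spec[of _ "a + 2 * R"])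
  have ball: "cball x0 (2 * R) \<subseteq> upper e a" by (rule cball_subset_upper[OF e x0(1)])
  have x0a: "x0 \<in> upper e a" "x0 \<in> upper e (a + R)" using x0(1) R(1) by (auto simp: upper_def)
  have start: "m + \<epsilon> \<le> u x" if x: "x \<in> cball x0 R" for x
  proof -
    have x2: "x \<in> cball x0 (2 * R)" using x R(1) by simp
    have "(m - \<eta>) + \<kappa> / 2 * (exp (- \<beta> * (dist x0 x)\<^sup>2) - exp (- \<beta> * (2 * R)\<^sup>2)) \<le> u x"
    proof (rule superharmonic_gaussian_bound[OF ua _ ball _ \<beta>])
      show "(m - \<eta>) + \<kappa> / 2 \<le> u w" if w: "w \<in> cball x0 (2 * R)" "dist x0 w \<le> r" for w
      proof -
        have wa: "w \<in> upper e a" using w(1) ball by blast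
        have "\<bar>u x0 - u w\<bar> \<le> C * dist x0 w" using lip(2) x0a(1) wa sub(2) by blast
        also have "\<dots> \<le> \<bar>C\<bar> * dist x0 w" by (intro mult_right_mono) auto
        also have "\<dots> \<le> (\<bar>C\<bar> + 1) * r" using w(2) r by (intro mult_mono) auto
        also have "\<dots> = \<kappa> / 2" by (simp add: r_def field_simps)
        finally show ?thesis using x0(2) \<eta>(1) by linarith
      qed
      show "- f (u w) \<le> 0" if "w \<in> upper e a" for w
        using f[OF u0] that sub(3) by force
    qed (use \<kappa> r ge ball x2 in auto)
    moreover have "exp (- \<beta> * R\<^sup>2) \<le> exp (- \<beta> * (dist x0 x)\<^sup>2)"
      using x \<beta>(1) by (auto intro!: power_mono mult_left_mono)
    then have "\<theta> \<le> \<kappa> / 2 * (exp (- \<beta> * (dist x0 x)\<^sup>2) - exp (- \<beta> * (2 * R)\<^sup>2))"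
      using \<kappa> unfolding \<theta>_def by (intro mult_left_mono) auto
    ultimately show ?thesis using \<eta>(2) \<epsilon>(3) by linarith
  qed
  have "m + \<epsilon> * (1 - exp (- N)) < u y" if y: "y \<in> upper e (a + R)" for y
    unfolding N_def
  proof (rule sliding_bump[OF ua e _ f \<alpha>(1) _ \<epsilon>(1,2) _ _ _ x0a(2) start y])
    show "8 * real DIM('a) * \<alpha> * (s - m) \<le> f s" if "m \<le> s" "s \<le> m + \<sigma>" for s
      using f_lower(3)[OF that] \<alpha>(2) by (simp add: N_def)
    show "m + \<epsilon> * (exp (- (real DIM('a) + 1)) - exp (- real DIM('a))) < u x" if "x \<in> upper e a" for x
      using ge[OF that] \<eta>(3) unfolding \<kappa>0_def N_def by (simp add: algebra_simps)
  qed (use R N_def u0 sub in auto)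
  moreover have "0 < \<epsilon> * (1 - exp (- N))" using \<epsilon>(1) N1 by simp
  moreover have "0 \<le> a + R" using sub(4) R by simp
  ultimately show False using near[of "\<epsilon> * (1 - exp (- N))" "a + R"] by force
qed

lemma has_lap_lipschitz:
  fixes u :: "'a::euclidean_space \<Rightarrow> real"
  assumes u: "has_lap (upper e a) u l" and e: "e \<in> Basis" and M: "0 < M"
    and bd: "\<And>x. x \<in> upper e a \<Longrightarrow> \<bar>u x\<bar> \<le> M" "\<And>x. x \<in> upper e a \<Longrightarrow> \<bar>l x\<bar> \<le> M"
  shows "\<exists>C. \<forall>x\<in>upper e (a + 1). \<forall>y\<in>upper e (a + 1). \<bar>u x - u y\<bar> \<le> C * dist x y"
proof -
  define C where "C = DIM('a) * M / 1 + 1 * M"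
  have sub: "upper e (a + 1) \<subseteq> upper e a" by (rule upper_mono) simp
  have grad: "\<bar>partial b u x\<bar> \<le> C" if "b \<in> Basis" "x \<in> upper e (a + 1)" for b x
    unfolding C_def by (rule gradient_bound_upper[OF u e that(1) _ M bd that(2)]) auto
  have pos: "\<bar>u (z + \<tau> *\<^sub>R b) - u z\<bar> \<le> C * \<tau>" if "z \<in> upper e (a + 1)" "b \<in> Basis" "0 < \<tau>" for z b \<tau>
  proof -
    have up: "z + t *\<^sub>R b \<in> upper e (a + 1)" if "0 \<le> t" for t
      by (rule upper_add_Basis[OF e \<open>b \<in> Basis\<close> \<open>z \<in> upper e (a + 1)\<close> that])
    have "\<exists>t. 0 < t \<and> t < \<tau> \<and> u (z + \<tau> *\<^sub>R b) - u (z + 0 *\<^sub>R b) = (\<tau> - 0) * partial b u (z + t *\<^sub>R b)"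
      by (intro MVT2 that has_lap_partial_at[OF u] subsetD[OF sub] up) auto
    then obtain t where t: "0 < t" "u (z + \<tau> *\<^sub>R b) - u z = \<tau> * partial b u (z + t *\<^sub>R b)" by auto
    have "\<tau> * \<bar>partial b u (z + t *\<^sub>R b)\<bar> \<le> \<tau> * C"
      using grad[OF that(2) up[of t]] t(1) that(3) by (intro mult_left_mono) auto
    then show ?thesis using t(2) that(3) by (simp add: abs_mult mult.commute)
  qed
  have "\<bar>u y - u x\<bar> \<le> DIM('a) * (C * dist x y)" if "x \<in> upper e (a + 1)" "y \<in> upper e (a + 1)" for x y
  proof (rule upper_axis_path[OF e that order_refl])
    fix z b \<tau> assume *: "z \<in> upper e (a + 1)" "b \<in> Basis" "z + \<tau> *\<^sub>R b \<in> upper e (a + 1)" "\<bar>\<tau>\<bar> \<le> dist x y"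
    have "\<bar>u (z + \<tau> *\<^sub>R b) - u z\<bar> \<le> C * \<bar>\<tau>\<bar>"
    proof (cases \<tau> "0::real" rule: linorder_cases)
      case greater
      then show ?thesis using pos[OF *(1,2)] by simp
    next
      case less
      then show ?thesis using pos[OF *(3,2), of "- \<tau>"] by (simp add: abs_minus_commute)
    qed simp
    also have "\<dots> \<le> C * dist x y" using *(4) M by (intro mult_left_mono) (auto simp: C_def)
    finally show "\<bar>u (z + \<tau> *\<^sub>R b) - u z\<bar> \<le> C * dist x y" .
  qed
  then show ?thesis by (intro exI[of _ "DIM('a) * C"]) (simp add: abs_minus_commute mult.assoc)
qed

lemma converges_to_positive_zero:
  fixes u :: "'a::euclidean_space \<Rightarrow> real"
  assumes u: "has_lap (upper e 0) u (\<lambda>x. - f (u x))" and e: "e \<in> Basis"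
    and u0: "\<And>x. x \<in> upper e 0 \<Longrightarrow> 0 \<le> u x" and uB: "\<And>x. x \<in> upper e 0 \<Longrightarrow> u x \<le> B"
    and f: "continuous_on {0..} f" "\<And>s. 0 \<le> s \<Longrightarrow> 0 \<le> f s"
    and f_lower: "\<And>z. 0 \<le> z \<Longrightarrow> f z = 0 \<Longrightarrow>
      \<exists>\<delta>>0. \<exists>\<sigma>>0. \<forall>s. z \<le> s \<longrightarrow> s \<le> z + \<sigma> \<longrightarrow> \<delta> * (s - z) \<le> f s"
    and x0: "x0 \<in> upper e 0" "0 < u x0"
  shows "\<exists>z>0. f z = 0 \<and> (\<forall>\<kappa>>0. \<exists>a\<ge>0. \<forall>x\<in>upper e a. \<bar>u x - z\<bar> \<le> \<kappa>)"
proof -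
  define i where "i a = Inf (u ` upper e a)" for a
  \<comment> \<open>\<open>i\<close> is nondecreasing and bounded by \<open>B\<close>, so this
    supremum is its limit at infinity. \<open>low\<close> and \<open>near\<close> are the two halves
    of that fact in the form used for comparison.\<close>
  define m where "m = Sup (i ` {0..})"
  have ne: "(a + 1) *\<^sub>R e \<in> upper e a" for a :: real using e by (simp add: upper_def)
  have sub: "upper e a \<subseteq> upper e 0" if "0 \<le> a" for a using that by (rule upper_mono)
  have bdd: "bdd_below (u ` upper e a)" if "0 \<le> a" for a
    using sub[OF that] u0 by (intro bdd_belowI[of _ 0]) auto
  have i_le: "i a \<le> u x" if "0 \<le> a" "x \<in> upper e a" for a x
    unfolding i_def using bdd that by (auto intro!: cInf_lower)
  have i_ge: "c \<le> i a" if "\<And>x. x \<in> upper e a \<Longrightarrow> c \<le> u x" for a c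
    unfolding i_def using ne[of a] that by (intro cInf_greatest) auto
  have i_mono: "i a \<le> i b" if "0 \<le> a" "a \<le> b" for a b
    using upper_mono[OF that(2), of e] i_le[OF that(1)] by (intro i_ge) auto
  have iB: "i a \<le> B" if "0 \<le> a" for a
    using i_le[OF that ne] uB ne sub[OF that] by (meson order_trans subsetD)
  have i_m: "i a \<le> m" if "0 \<le> a" for a
    unfolding m_def using that iB by (intro cSup_upper bdd_aboveI[of _ B]) auto
  have m0: "0 \<le> m" using i_m[of 0] i_ge[of 0 0] u0 by force
  have low: "\<exists>a\<ge>0. \<forall>x\<in>upper e a. m - \<eta> \<le> u x" if "0 < \<eta>" for \<eta>
  proof -
    have "\<exists>y\<in>i ` {0..}. m - \<eta> < y"
      unfolding m_def using that by (intro less_cSupD) (auto simp: m_def[symmetric])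
    then obtain a where "0 \<le> a" "m - \<eta> < i a" by auto
    then show ?thesis using i_le[of a] by (intro exI[of _ a]) force
  qed
  have near: "\<exists>x\<in>upper e a. u x < m + \<eta>" if "0 < \<eta>" "0 \<le> a" for \<eta> a
  proof (rule ccontr)
    assume "\<not> ?thesis"
    then have "m + \<eta> \<le> i a" by (intro i_ge) (auto simp: not_less)
    then show False using i_m[OF that(2)] that(1) by simp
  qed
  have fm: "f m = 0" by (rule zero_of_limit_inf[OF u e u0 f m0 low near])
  have "0 < m"
  proof (rule ccontr)
    assume "\<not> 0 < m"
    then have "m = 0" using m0 by simp
    then obtain \<delta> \<sigma> where "0 < \<delta>" "0 < \<sigma>" "\<And>s. 0 \<le> s \<Longrightarrow> s \<le> \<sigma> \<Longrightarrow> \<delta> * s \<le> f s"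
      using f_lower[OF m0 fm] by auto
    from eventually_bounded_below_pos[OF u e u0 f(2) this x0]
    obtain c a where c: "0 < c" "0 \<le> a" "\<forall>y\<in>upper e a. c < u y" by blast
    have "c \<le> i a" using c(3) by (intro i_ge) (simp add: less_imp_le)
    then show False using i_m[OF c(2)] \<open>m = 0\<close> c(1) by simp
  qed
  have "0 \<le> B" using u0[OF x0(1)] uB[OF x0(1)] by linarith
  have "bounded (f ` {0..B})"
    by (intro compact_imp_bounded compact_continuous_image continuous_on_subset[OF f(1)]) auto
  then obtain F where F: "\<And>s. 0 \<le> s \<Longrightarrow> s \<le> B \<Longrightarrow> \<bar>f s\<bar> \<le> F"
    unfolding bounded_iff by (metis atLeastAtMost_iff imageI real_norm_def)
  have "\<exists>C. \<forall>x\<in>upper e (0 + 1). \<forall>y\<in>upper e (0 + 1). \<bar>u x - u y\<bar> \<le> C * dist x y"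
  proof (rule has_lap_lipschitz[OF u e, of "\<bar>F\<bar> + B + 1"])
    show "\<bar>u x\<bar> \<le> \<bar>F\<bar> + B + 1" "\<bar>- f (u x)\<bar> \<le> \<bar>F\<bar> + B + 1" if "x \<in> upper e 0" for x
      using u0[OF that] uB[OF that] F[of "u x"] by auto
  qed (use \<open>0 \<le> B\<close> in auto)
  then obtain C where C: "\<And>x y. x \<in> upper e 1 \<Longrightarrow> y \<in> upper e 1 \<Longrightarrow> \<bar>u x - u y\<bar> \<le> C * dist x y"
    by auto
  obtain \<delta> \<sigma> where \<delta>: "0 < \<delta>" "0 < \<sigma>" "\<And>s. m \<le> s \<Longrightarrow> s \<le> m + \<sigma> \<Longrightarrow> \<delta> * (s - m) \<le> f s"
    using f_lower[OF m0 fm] by auto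
  have "\<exists>a\<ge>0. \<forall>x\<in>upper e a. \<bar>u x - m\<bar> \<le> \<kappa>" if \<kappa>: "0 < \<kappa>" for \<kappa>
  proof -
    obtain a where a: "0 \<le> a" "\<forall>x\<in>upper e a. u x \<le> m + \<kappa>"
      using limit_inf_is_limit[OF u e u0 f(2) \<delta> low near zero_le_one C \<kappa>] by blast
    obtain b where b: "0 \<le> b" "\<forall>x\<in>upper e b. m - \<kappa> \<le> u x" using low[OF \<kappa>] by blast
    have "\<forall>x\<in>upper e (max a b). \<bar>u x - m\<bar> \<le> \<kappa>"
      using a(2) b(2) upper_mono[of a "max a b" e] upper_mono[of b "max a b" e]
      by (auto simp: abs_le_iff algebra_simps subset_iff)
    then show ?thesis using a(1) by (intro exI[of _ "max a b"]) auto
  qed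
  then show ?thesis using fm \<open>0 < m\<close> by blast
qed

section \<open>Convergence in \<open>C\<^sup>2\<^sup>,\<^sup>\<beta>\<close>\<close>

lemma sup_norm_le: "(\<And>x. x \<in> S \<Longrightarrow> \<bar>g x\<bar> \<le> M) \<Longrightarrow> sup_norm S g \<le> ennreal M"
  unfolding sup_norm_def by (intro SUP_least ennreal_leI)

text \<open>Pairs at distance at most 1 use t powr \<gamma> \<le> t powr \<beta>. For more distant
  pairs the numerator is at most 2 M and the denominator at least 1.\<close>

lemma holder_seminorm_le:
  assumes "0 \<le> \<beta>" "\<beta> \<le> \<gamma>" "0 \<le> M" and g: "\<And>x. x \<in> S \<Longrightarrow> \<bar>g x\<bar> \<le> M"
    and h: "\<And>x y. x \<in> S \<Longrightarrow> y \<in> S \<Longrightarrow> dist x y \<le> 1 \<Longrightarrow> \<bar>g x - g y\<bar> \<le> M * dist x y powr \<gamma>"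
  shows "holder_seminorm \<beta> S g \<le> ennreal (2 * M)"
  unfolding holder_seminorm_def
proof (intro SUP_least ennreal_leI)
  fix x y assume "x \<in> S" "y \<in> S - {x}"
  then have xy: "x \<in> S" "y \<in> S" "0 < dist x y" by auto
  show "\<bar>g x - g y\<bar> / dist x y powr \<beta> \<le> 2 * M"
  proof (cases "dist x y \<le> 1")
    case True
    have "\<bar>g x - g y\<bar> \<le> M * dist x y powr \<gamma>" by (rule h[OF xy(1,2) True])
    also have "\<dots> \<le> (2 * M) * dist x y powr \<beta>"
      using assms True xy(3) by (intro mult_mono powr_mono') auto
    finally show ?thesis using xy(3) by (simp add: divide_le_eq)
  next
    case False
    have "\<bar>g x - g y\<bar> \<le> 2 * M * 1" using g[OF xy(1)] g[OF xy(2)] by linarith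
    also have "\<dots> \<le> 2 * M * dist x y powr \<beta>"
      using assms False by (intro mult_left_mono ge_one_powr_ge_zero) auto
    finally show ?thesis using xy(3) by (simp add: divide_le_eq)
  qed
qed

lemma C2_on_subset: "C2_on V w \<Longrightarrow> U \<subseteq> V \<Longrightarrow> C2_on U w"
  unfolding C2_on_def by (meson continuous_on_subset subsetD)

text \<open>The partial derivatives are continuous on all of \<open>V\<close>, so they serve as
  their own extensions from \<open>interior K\<close> to \<open>K\<close>.\<close>

lemma C2_on_imp_C2_closed:
  assumes w: "C2_on V w" and K: "K \<subseteq> V"
  shows "C2_closed K w"
proof -
  have "continuous_on K w" "\<And>b. b \<in> Basis \<Longrightarrow> continuous_on K (partial b w)"
    "\<And>b c. b \<in> Basis \<Longrightarrow> c \<in> Basis \<Longrightarrow> continuous_on K (partial c (partial b w))"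
    using C2_on_subset[OF w K] by (auto simp: C2_on_def)
  moreover have "C2_on (interior K) w"
    using C2_on_subset[OF w] K interior_subset by blast
  ultimately show ?thesis unfolding C2_closed_def by blast
qed

lemma C2b_norm_le:
  fixes w :: "'a::euclidean_space \<Rightarrow> real" and M :: real
  assumes w: "C2_on V w" and F: "F \<subseteq> V" and "0 \<le> \<beta>" "\<beta> \<le> \<gamma>" "0 \<le> M"
    and bd: "\<And>x. x \<in> F \<Longrightarrow> \<bar>w x\<bar> \<le> M"
      "\<And>b x. b \<in> Basis \<Longrightarrow> x \<in> F \<Longrightarrow> \<bar>partial b w x\<bar> \<le> M"
      "\<And>b c x. b \<in> Basis \<Longrightarrow> c \<in> Basis \<Longrightarrow> x \<in> F \<Longrightarrow> \<bar>partial c (partial b w) x\<bar> \<le> M"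
      "\<And>b c x y. b \<in> Basis \<Longrightarrow> c \<in> Basis \<Longrightarrow> x \<in> F \<Longrightarrow> y \<in> F \<Longrightarrow> dist x y \<le> 1 \<Longrightarrow>
        \<bar>partial c (partial b w) x - partial c (partial b w) y\<bar> \<le> M * dist x y powr \<gamma>"
  shows "C2b_norm \<beta> F w \<le> ennreal ((1 + real DIM('a) + 3 * (real DIM('a))\<^sup>2) * M)"
  unfolding C2b_norm_def
proof (rule SUP_least)
  fix x
  define N where "N = real DIM('a)"
  define K where "K = cball x 1 \<inter> F"
  have K: "K \<subseteq> F" "interior K \<subseteq> F" unfolding K_def using interior_subset by blast+
  have "C2_closed K w" by (rule C2_on_imp_C2_closed[OF w]) (use K F in auto)
  then have "C2_holder_norm \<beta> K w = sup_norm K w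
       + (\<Sum>b\<in>Basis. sup_norm (interior K) (partial b w))
       + (\<Sum>b\<in>Basis. \<Sum>c\<in>Basis. sup_norm (interior K) (partial c (partial b w)))
       + (\<Sum>b\<in>Basis. \<Sum>c\<in>Basis. holder_seminorm \<beta> (interior K) (partial c (partial b w)))"
    by (simp add: C2_holder_norm_def)
  \<comment> \<open>The final constant counts terms: 1 for the function, N for the gradient, N^2 for
    the second derivatives and 2 N^2 for the seminorms, each at most 2 M.\<close>
  also have "\<dots> \<le> ennreal M + (\<Sum>b\<in>(Basis::'a set). ennreal M) + (\<Sum>b\<in>(Basis::'a set). \<Sum>c\<in>(Basis::'a set). ennreal M)
      + (\<Sum>b\<in>(Basis::'a set). \<Sum>c\<in>(Basis::'a set). ennreal (2 * M))"
    by (intro add_mono sum_mono sup_norm_le holder_seminorm_le[OF assms(3-5)] bd) (use K in auto)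
  also have "\<dots> = ennreal (M + N * M + N * (N * M) + N * (N * (2 * M)))"
    using \<open>0 \<le> M\<close> unfolding N_def
    by (simp add: sum_constant ennreal_of_nat_eq_real_of_nat flip: ennreal_mult ennreal_plus)
  also have "M + N * M + N * (N * M) + N * (N * (2 * M)) = (1 + N + 3 * N\<^sup>2) * M"
    by (simp add: algebra_simps power2_eq_square)
  finally show "C2_holder_norm \<beta> (cball x 1 \<inter> F) w \<le> ennreal ((1 + real DIM('a) + 3 * (real DIM('a))\<^sup>2) * M)"
    by (simp add: K_def N_def)
qed

lemma partial_shift: "partial b (\<lambda>x. u (x + s)) = (\<lambda>x. partial b u (x + s))"
  unfolding partial_def by (simp add: add_ac)

lemma partial_const: "partial b (\<lambda>x. c) = (\<lambda>x. 0)"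
  unfolding partial_def by (intro ext DERIV_imp_deriv) simp

lemma C2_on_const: "C2_on S (\<lambda>x. c)"
  by (auto simp: C2_on_def partial_const has_partial_def)

lemma C2_on_shift_diff_const:
  assumes "C2_on S u" "\<And>x. x \<in> T \<Longrightarrow> x + s \<in> S"
  shows "C2_on T (\<lambda>x. u (x + s) - d)"
proof -
  have cont: "continuous_on T (\<lambda>x. v (x + s))" if "continuous_on S v" for v :: "'a \<Rightarrow> real"
    by (rule continuous_on_compose2[OF that]) (use assms(2) in \<open>auto intro!: continuous_intros\<close>)
  have shift: "has_partial b (\<lambda>x. v (x + s)) x = has_partial b v (x + s)" for b v and x :: 'a
    unfolding has_partial_def by (simp add: add_ac)
  have diff: "has_partial b (\<lambda>x. v x - d) x" if "has_partial b v x" for b v and x :: 'a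
    using that unfolding has_partial_def by (intro differentiable_diff) auto
  show ?thesis
    using assms unfolding C2_on_def partial_diff_const partial_shift
    by (auto intro!: diff continuous_on_diff cont simp: shift)
qed

lemma tendsto_C2b_of_uniform_limit:
  fixes u :: "'a::euclidean_space \<Rightarrow> real" and f :: "real \<Rightarrow> real" and L z :: real
  assumes u: "C2_on (upper e 0) u" and e: "e \<in> Basis" and L: "0 < L" "L-lipschitz_on J f"
    and J: "\<And>x. x \<in> upper e 0 \<Longrightarrow> u x \<in> J" "z \<in> J" and z: "f z = 0"
    and eq: "\<And>x. x \<in> upper e 0 \<Longrightarrow> laplacian u x = - f (u x)"
    and lim: "\<And>\<kappa>. 0 < \<kappa> \<Longrightarrow> \<exists>a\<ge>0. \<forall>x\<in>upper e a. \<bar>u x - z\<bar> \<le> \<kappa>"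
    and \<beta>: "0 \<le> \<beta>" "\<beta> < 1"
  shows "tendsto_C2b \<beta> {x. A \<le> x \<bullet> e} (\<lambda>h x. u (x + h *\<^sub>R e)) (\<lambda>_. z) at_top"
proof -
  define F where "F = {x. A \<le> x \<bullet> e}"
  define P where "P = 1 + real DIM('a) + 3 * (real DIM('a))\<^sup>2"
  have P: "1 \<le> P" by (simp add: P_def)
  \<comment> \<open>The available exponents 1 - (1/2)^n tend to 1, so one of them exceeds
    \<beta>.\<close>
  obtain n where n: "(1 / 2 :: real) ^ n < 1 - \<beta>"
    using real_arch_pow_inv[of "1 - \<beta>" "1 / 2"] \<beta> by auto
  define \<gamma> where "\<gamma> = 1 - (1 / 2 :: real) ^ n"
  have \<beta>\<gamma>: "\<beta> \<le> \<gamma>" using n by (simp add: \<gamma>_def)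
  from derivative_estimates[OF u e L J z eq, of n, folded \<gamma>_def]
  obtain K R where K: "0 < K" and R: "0 \<le> R" and est: "\<forall>a\<ge>0. \<forall>M>0. (\<forall>x\<in>upper e a. \<bar>u x - z\<bar> \<le> M) \<longrightarrow>
    (\<forall>b\<in>Basis. \<forall>c\<in>Basis. \<forall>x\<in>upper e (a + R). \<bar>partial b u x\<bar> \<le> K * M \<and>
      \<bar>partial b (partial c u) x\<bar> \<le> K * M \<and>
      (\<forall>y\<in>upper e (a + R). dist x y \<le> 1 \<longrightarrow>
        \<bar>partial b (partial c u) x - partial b (partial c u) y\<bar> \<le> K * M * dist x y powr \<gamma>))"
    by blast
  \<comment> \<open>The constant d is left open: d = z yields the convergence, d = 0 the membership
    of the translates in the space.\<close>
  have norm_le: "C2b_norm \<beta> F (\<lambda>x. u (x + h *\<^sub>R e) - d) \<le> ennreal (P * ((K + 1) * M + \<bar>z - d\<bar>))"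
    if a: "0 \<le> a" and M: "0 < M" and bd: "\<forall>x\<in>upper e a. \<bar>u x - z\<bar> \<le> M" and h: "a + R < A + h" for a M h d
  proof -
    define B where "B = (K + 1) * M + \<bar>z - d\<bar>"
    have B: "K * M \<le> B" "M + \<bar>z - d\<bar> \<le> B" "0 \<le> B" using K M by (auto simp: B_def algebra_simps)
    \<comment> \<open>\<open>est\<close> is instantiated with both orders of \<open>b\<close> and
      \<open>c\<close>, so symmetry of the second derivatives is not invoked.\<close>
    have D: "\<bar>partial b u x\<bar> \<le> K * M" "\<bar>partial c (partial b u) x\<bar> \<le> K * M"
      "dist x y \<le> 1 \<Longrightarrow> \<bar>partial c (partial b u) x - partial c (partial b u) y\<bar> \<le> K * M * dist x y powr \<gamma>"
      if "b \<in> Basis" "c \<in> Basis" "x \<in> upper e (a + R)" "y \<in> upper e (a + R)" for b c x y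
      using est[rule_format, OF a M bd[rule_format] that(1,2,3)]
        est[rule_format, OF a M bd[rule_format] that(2,1,3)] that(4) by blast+
    have up: "x + h *\<^sub>R e \<in> upper e (a + R)" if "x \<in> F" for x
      using that h e by (simp add: F_def upper_def inner_simps)
    have sub: "upper e (a + R) \<subseteq> upper e a" "upper e (a + R) \<subseteq> upper e 0"
      using a R by (auto intro!: upper_mono)
    show ?thesis unfolding P_def B_def[symmetric]
    proof (rule C2b_norm_le[OF C2_on_shift_diff_const[OF u, where T = F and s = "h *\<^sub>R e" and d = d]
          order_refl \<beta>(1) \<beta>\<gamma> B(3)], unfold partial_diff_const partial_shift)
      show "x + h *\<^sub>R e \<in> upper e 0" if "x \<in> F" for x using up[OF that] sub by blast
      show "\<bar>u (x + h *\<^sub>R e) - d\<bar> \<le> B" if "x \<in> F" for x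
      proof -
        have "\<bar>u (x + h *\<^sub>R e) - z\<bar> \<le> M" using bd up[OF that] sub by blast
        then show ?thesis using B(2) by linarith
      qed
      show "\<bar>partial b u (x + h *\<^sub>R e)\<bar> \<le> B" if "b \<in> Basis" "x \<in> F" for b x
        using D(1)[OF that(1,1) up[OF that(2)] up[OF that(2)]] B(1) by linarith
      show "\<bar>partial c (partial b u) (x + h *\<^sub>R e)\<bar> \<le> B" if "b \<in> Basis" "c \<in> Basis" "x \<in> F" for b c x
        using D(2)[OF that(1,2) up[OF that(3)] up[OF that(3)]] B(1) by linarith
      show "\<bar>partial c (partial b u) (x + h *\<^sub>R e) - partial c (partial b u) (y + h *\<^sub>R e)\<bar> \<le> B * dist x y powr \<gamma>"
        if "b \<in> Basis" "c \<in> Basis" "x \<in> F" "y \<in> F" "dist x y \<le> 1" for b c x y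
      proof -
        have "\<bar>partial c (partial b u) (x + h *\<^sub>R e) - partial c (partial b u) (y + h *\<^sub>R e)\<bar> \<le> K * M * dist x y powr \<gamma>"
          using D(3)[OF that(1,2) up[OF that(3)] up[OF that(4)]] that(5) by simp
        also have "\<dots> \<le> B * dist x y powr \<gamma>" using B(1) by (intro mult_right_mono) auto
        finally show ?thesis .
      qed
    qed
  qed
  have ev: "\<forall>\<^sub>F h in at_top. C2b_norm \<beta> F (\<lambda>x. u (x + h *\<^sub>R e) - d) \<le> ennreal (P * ((K + 1) * M + \<bar>z - d\<bar>))"
    if "0 < M" for d M
  proof -
    obtain a where a: "0 \<le> a" "\<forall>x\<in>upper e a. \<bar>u x - z\<bar> \<le> M" using lim[OF \<open>0 < M\<close>] by blast
    show ?thesis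
      using eventually_gt_at_top[of "a + R - A"]
      by eventually_elim (rule norm_le[OF a(1) \<open>0 < M\<close> a(2)], linarith)
  qed
  have "C2b_norm \<beta> F (\<lambda>_. z) \<le> ennreal (P * \<bar>z\<bar>)"
    unfolding P_def
    by (rule C2b_norm_le[OF C2_on_const subset_UNIV \<beta>(1) order_refl]) (simp_all add: partial_const)
  then have "(\<lambda>_. z) \<in> C2b_space \<beta> F"
    unfolding C2b_space_def by (auto simp: le_less_trans[OF _ ennreal_less_top])
  moreover have "\<forall>\<^sub>F h in at_top. (\<lambda>x. u (x + h *\<^sub>R e)) \<in> C2b_space \<beta> F"
    using ev[OF zero_less_one, of 0]
  proof eventually_elim
    case (elim h)
    then show ?case unfolding C2b_space_def by (auto simp: le_less_trans[OF _ ennreal_less_top])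
  qed
  moreover have "((\<lambda>h. C2b_norm \<beta> F (\<lambda>x. u (x + h *\<^sub>R e) - z)) \<longlongrightarrow> 0) at_top"
  proof (rule order_tendstoI)
    fix \<epsilon> :: ennreal assume "0 < \<epsilon>"
    then obtain r' where r': "0 < r'" "r' < \<epsilon>" using dense by blast
    obtain r where r: "r' = ennreal r" "0 \<le> r" using r'(2) by (cases r') auto
    then have "0 < r" using r'(1) by simp
    then have M: "0 < r / (P * (K + 1))" using P K by simp
    show "\<forall>\<^sub>F h in at_top. C2b_norm \<beta> F (\<lambda>x. u (x + h *\<^sub>R e) - z) < \<epsilon>"
      using ev[OF M, of z]
    proof eventually_elim
      case (elim h)
      also have "P * ((K + 1) * (r / (P * (K + 1))) + \<bar>z - z\<bar>) = r" using P K by simp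
      finally show ?case using r'(2) r(1) by simp
    qed
  qed simp
  ultimately show ?thesis unfolding tendsto_C2b_def F_def by blast
qed

section \<open>Consequences of the hypotheses on \<open>f\<close>\<close>

lemma Liminf_slope_pos:
  fixes f :: "real \<Rightarrow> real"
  assumes "Liminf (at_right z) (\<lambda>s. ereal (f s / (s - z))) > 0" "f z = 0"
  shows "\<exists>\<delta>>0. \<exists>\<sigma>>0. \<forall>s. z \<le> s \<longrightarrow> s \<le> z + \<sigma> \<longrightarrow> \<delta> * (s - z) \<le> f s"
proof -
  obtain \<delta> where \<delta>: "0 < ereal \<delta>" "ereal \<delta> < Liminf (at_right z) (\<lambda>s. ereal (f s / (s - z)))"
    using ereal_dense2[OF assms(1)] by blast
  have "\<forall>\<^sub>F s in at_right z. ereal \<delta> < ereal (f s / (s - z))"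
    by (rule less_LiminfD[OF \<delta>(2)])
  then obtain b :: real where b: "z < b" "\<And>s. z < s \<Longrightarrow> s < b \<Longrightarrow> \<delta> < f s / (s - z)"
    by (auto simp: eventually_at_right_field)
  \<comment> \<open>Halving b - z keeps the closed interval below b. The end point s = z, invisible
    to the limes inferior, is covered by f z = 0.\<close>
  have "\<delta> * (s - z) \<le> f s" if "z \<le> s" "s \<le> z + (b - z) / 2" for s
  proof (cases "s = z")
    case False
    then have "z < s" "s < b" using that b(1) by (auto simp: field_simps)
    then show ?thesis using b(2)[of s] by (simp add: less_divide_eq)
  qed (simp add: assms(2))
  then show ?thesis using \<delta>(1) b(1) by (intro exI[of _ \<delta>] conjI exI[of _ "(b - z) / 2"]) auto
qed

lemma locally_lipschitz_imp_continuous_on: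
  fixes f :: "real \<Rightarrow> real"
  assumes "\<forall>s\<in>{0..}. \<exists>r>0. \<exists>L. L-lipschitz_on (cball s r \<inter> {0..}) f"
  shows "continuous_on {0..} f"
  unfolding continuous_on_eq_continuous_within
proof
  fix s :: real assume s: "s \<in> {0..}"
  then obtain r L where r: "0 < r" "L-lipschitz_on (cball s r \<inter> {0..}) f" using assms by blast
  then have "continuous (at s within cball s r \<inter> {0..}) f"
    using lipschitz_on_continuous_on[OF r(2)] s by (simp add: continuous_on_eq_continuous_within)
  moreover have "at s within cball s r \<inter> {0..} = at s within {0..}"
    by (rule at_within_nhd[of _ "ball s r"]) (use r in auto)
  ultimately show "continuous (at s within {0..}) f" by simp
qed

lemma locally_lipschitz_imp_lipschitz_on:
  fixes f :: "real \<Rightarrow> real"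
  assumes "\<forall>s\<in>{0..}. \<exists>r>0. \<exists>L. L-lipschitz_on (cball s r \<inter> {0..}) f"
  obtains L where "0 < L" "L-lipschitz_on {0..b} f"
proof -
  \<comment> \<open>The compactness theorem concerns families indexed by time; a one-point set of
    times turns \<open>f\<close> into such a family.\<close>
  have "local_lipschitz {0::real} {0..b} (\<lambda>_. f)"
  proof (rule local_lipschitzI)
    fix t s assume "s \<in> {0..b}"
    then obtain r L where "0 < r" "L-lipschitz_on (cball s r \<inter> {0..}) f" using assms by force
    then show "\<exists>u>0. \<exists>L. \<forall>t\<in>cball t u \<inter> {0::real}. L-lipschitz_on (cball s u \<inter> {0..b}) f"
      by (meson lipschitz_on_subset Int_mono order_refl atLeastAtMost_iff atLeast_iff subsetI)
  qed
  then obtain L where "L-lipschitz_on {0..b} f"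
    using local_lipschitz_compact_implies_lipschitz[of "{0::real}" "{0..b}" "\<lambda>_. f"] by (auto simp: continuous_on_const)
  then show thesis by (intro that[of "\<bar>L\<bar> + 1"]) (auto intro: lipschitz_on_le)
qed

theorem theorem1p3:
  fixes f :: "real \<Rightarrow> real"
    and u\<^sub>0 :: "real ^ 'm \<Rightarrow> real"
    and u :: "real \<times> (real ^ 'm) \<Rightarrow> real"
  assumes f_lipschitz: "\<forall>s\<in>{0..}. \<exists>r>0. \<exists>L. L-lipschitz_on (cball s r \<inter> {0..}) f"
    and f_nonneg: "\<forall>s\<in>{0..}. f s \<ge> 0"
    and f_zeros: "\<forall>z\<in>zeros f. Liminf (at_right z) (\<lambda>s. ereal (f s / (s - z))) > 0"
    and u0_cont: "continuous_on UNIV u\<^sub>0"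
    and u0_bounded: "bounded (range u\<^sub>0)"
    and u0_nonneg: "\<forall>y. u\<^sub>0 y \<ge> 0"
    and u0_nonzero: "\<exists>y. u\<^sub>0 y \<noteq> 0"
    and u_solution: "bounded_solution half_space f u"
    and u_nonneg: "\<forall>x\<in>closure half_space. u x \<ge> 0"
    and u_boundary: "\<forall>y. u (0, y) = u\<^sub>0 y"
  shows "\<exists>z\<in>zeros f - {0}. \<forall>A::real. \<forall>\<beta>\<in>{0..<1}.
           tendsto_C2b \<beta> ({A..} \<times> UNIV) (\<lambda>h (x\<^sub>1, x'). u (x\<^sub>1 + h, x')) (\<lambda>_. z) at_top"
proof -
  define e :: "real \<times> (real ^ 'm)" where "e = (1, 0)"
  have e: "e \<in> Basis" by (simp add: e_def Basis_prod_def)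
  have half_space: "half_space = upper e 0"
    by (auto simp: upper_def e_def inner_prod_def)
  have sub: "upper e 0 \<subseteq> closure half_space" unfolding half_space by (rule closure_subset)
  have u: "C2_on (upper e 0) u" and cont: "continuous_on (closure half_space) u"
    and bdd: "bounded (u ` closure half_space)" and "\<forall>x\<in>half_space. laplacian u x + f (u x) = 0"
    using u_solution unfolding bounded_solution_def half_space by auto
  then have eq: "laplacian u x = - f (u x)" if "x \<in> upper e 0" for x
    using that unfolding half_space by (simp add: eq_neg_iff_add_eq_0)
  have lap: "has_lap (upper e 0) u (\<lambda>x. - f (u x))"
    by (rule has_lap_cong[OF C2_on_has_lap[OF u] eq])
  obtain B where "\<And>x. x \<in> closure half_space \<Longrightarrow> \<bar>u x\<bar> \<le> B"
    using bdd unfolding bounded_iff by auto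
  then have B: "u x \<le> B" if "x \<in> upper e 0" for x
    using sub that by (meson abs_le_D1 subsetD)
  have u0: "0 \<le> u x" if "x \<in> upper e 0" for x using u_nonneg sub that by blast
  obtain y where "0 < u\<^sub>0 y" using u0_nonzero u0_nonneg by (metis order_le_less)
  \<comment> \<open>The boundary values enter here: if \<open>u\<close> vanished in the open
    half-space, continuity up to the boundary would give u (0, y) = 0.\<close>
  have "\<exists>x0\<in>upper e 0. 0 < u x0"
  proof (rule ccontr)
    assume "\<not> ?thesis"
    then have "u x = 0" if "x \<in> half_space" for x
      using u0[of x] that unfolding half_space by force
    then have "u (0, y) = 0"
      by (rule continuous_constant_on_closure[OF cont]) (simp_all add: closure_Times)
    then show False using u_boundary \<open>0 < u\<^sub>0 y\<close> by simp
  qed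
  then obtain x0 where x0: "x0 \<in> upper e 0" "0 < u x0" by blast
  have "\<exists>z>0. f z = 0 \<and> (\<forall>\<kappa>>0. \<exists>a\<ge>0. \<forall>x\<in>upper e a. \<bar>u x - z\<bar> \<le> \<kappa>)"
  proof (rule converges_to_positive_zero[OF lap e u0 B])
    show "continuous_on {0..} f" by (rule locally_lipschitz_imp_continuous_on[OF f_lipschitz])
    show "\<exists>\<delta>>0. \<exists>\<sigma>>0. \<forall>s. z \<le> s \<longrightarrow> s \<le> z + \<sigma> \<longrightarrow> \<delta> * (s - z) \<le> f s"
      if "0 \<le> z" "f z = 0" for z
      by (rule Liminf_slope_pos) (use f_zeros that in \<open>auto simp: zeros_def\<close>)
  qed (use f_nonneg x0 in auto)
  then obtain z where z: "0 < z" "f z = 0"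
    and lim: "\<And>\<kappa>. 0 < \<kappa> \<Longrightarrow> \<exists>a\<ge>0. \<forall>x\<in>upper e a. \<bar>u x - z\<bar> \<le> \<kappa>" by blast
  \<comment> \<open>The interval must contain the limit \<open>z\<close> along with the values of
    \<open>u\<close>, since f (u x) is compared with f z.\<close>
  obtain L where L: "0 < L" "L-lipschitz_on {0..max B z} f"
    using locally_lipschitz_imp_lipschitz_on[OF f_lipschitz] by blast
  have "tendsto_C2b \<beta> ({A..} \<times> UNIV) (\<lambda>h (x\<^sub>1, x'). u (x\<^sub>1 + h, x')) (\<lambda>_. z) at_top"
    if "\<beta> \<in> {0..<1}" for A \<beta>
  proof -
    have "tendsto_C2b \<beta> {x. A \<le> x \<bullet> e} (\<lambda>h x. u (x + h *\<^sub>R e)) (\<lambda>_. z) at_top"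
    proof (rule tendsto_C2b_of_uniform_limit[OF u e L _ _ z(2) eq lim])
      show "u x \<in> {0..max B z}" if "x \<in> upper e 0" for x
        using u0[OF that] B[OF that] by auto
    qed (use that z in auto)
    moreover have "{x. A \<le> x \<bullet> e} = {A..} \<times> UNIV" by (auto simp: e_def inner_prod_def)
    moreover have "(\<lambda>h x. u (x + h *\<^sub>R e)) = (\<lambda>h (x\<^sub>1, x'). u (x\<^sub>1 + h, x'))"
      by (auto simp: e_def fun_eq_iff)
    ultimately show ?thesis by simp
  qed
  then show ?thesis using z by (intro bexI[of _ z]) (auto simp: zeros_def)
qed

end
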